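(* Let $\hat f=\sum_{\boldsymbol{N}\in\mathbb{N}_0^n}f_{\boldsymbol{N}}\boldsymbol{z}^{\boldsymbol{N}}\in\mathbb{C}[[\boldsymbol{z}]]$ be a $\boldsymbol{1}$-Gevrey series of type $\boldsymbol{R}=(R_1,\dots,R_n)\in(0,\infty)^n$, i.e. for every $\delta>0$ there is $C>0$ with $|f_{\boldsymbol{N}}|\le C\boldsymbol{N}!\prod_j(1/R_j+\delta)^{N_j}$. Let $\varphi(\boldsymbol{t})=\sum_{\boldsymbol{N}}f_{\boldsymbol{N}}\boldsymbol{t}^{\boldsymbol{N}}/\boldsymbol{N}!$ (convergent in the polydisc $D(\boldsymbol{0},\boldsymbol{R})$), take $\boldsymbol{z}_0=(z_{01},\dots,z_{0n})\in D(\boldsymbol{0},\boldsymbol{R})$ with all $z_{0j}\ne0$, and let $$F(\boldsymbol{z})=\frac{1}{z_1\cdots z_n}\int_0^{z_{01}}\!\!\cdots\int_0^{z_{0n}}\varphi(\boldsymbol{t})\exp\Big(-\frac{t_1}{z_1}-\dots-\frac{t_n}{z_n}\Big)dt_1\cdots dt_n,$$ holomorphic on $S_0=\prod_{j=1}^nS(\arg z_{0j}-\frac{\pi}{2},\arg z_{0j}+\frac{\pi}{2};\infty)$ (integrals along segments). For $\emptyset\ne J\subsetneq\{1,\dots,n\}$ and $\boldsymbol{\alpha}_J\in\mathbb{N}_0^J$ let $\varphi_{\boldsymbol{\alpha}_J}(\boldsymbol{t}_{J'})=\sum_{\boldsymbol{\alpha}_{J'}\in\mathbb{N}_0^{J'}}f_{(\boldsymbol{\alpha}_J,\boldsymbol{\alpha}_{J'})}\boldsymbol{t}_{J'}^{\boldsymbol{\alpha}_{J'}}/\boldsymbol{\alpha}_{J'}!$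 and $$F_{\boldsymbol{\alpha}_J}(\boldsymbol{z}_{J'})=\Big(\prod_{j\in J'}z_j\Big)^{-1}\Big(\prod_{j\in J'}\int_0^{z_{0j}}\Big)\varphi_{\boldsymbol{\alpha}_J}(\boldsymbol{t}_{J'})\exp\Big(-\sum_{j\in J'}\frac{t_j}{z_j}\Big)\prod_{j\in J'}dt_j,$$ and for $J=\{1,\dots,n\}$ let $F_{\boldsymbol{\alpha}}=f_{\boldsymbol{\alpha}}$; put $\mathcal{F}(\hat f)=\{F_{\boldsymbol{\alpha}_J}:\emptyset\ne J\subset\{1,\dots,n\},\ \boldsymbol{\alpha}_J\in\mathbb{N}_0^J\}$. Then $F$ has $\mathcal{F}(\hat f)$ as total family of $\boldsymbol{1}$-Gevrey strong asymptotic expansion in $S_0$. Moreover, for every multidirection $\boldsymbol{\theta}$ in $S_0$, the type of this expansion following $\boldsymbol{\theta}$ is $\boldsymbol{R}(\boldsymbol{\theta})=(R_1(\theta_1),\dots,R_n(\theta_n))$ with $R_j(\theta_j)=|z_{0j}|\cos(\theta_j-\arg z_{0j})$.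
   Context: Notation: $\mathcal{N}=\{1,\dots,n\}$, $J'=\mathcal{N}\setminus J$, $\boldsymbol{z}_J$ restriction of $\boldsymbol{z}$ to coordinates in $J$; multi-index operations componentwise ($\boldsymbol{H}<\boldsymbol{N}$ means $H_j<N_j$ for all $j$). A sector is $S(\alpha,\beta;\rho)=\{z:0<|z|<\rho,\arg z\in(\alpha,\beta)\}$; polysectors are products; a multidirection $\boldsymbol{\theta}$ satisfies $\alpha_j<\theta_j<\beta_j$; $T\prec S$ means $T=\prod T_j$, $T_j$ bounded sectors with $\overline{T_j}\setminus\{0\}\subset S_j$. For a family $\mathcal{F}=\{f_{\boldsymbol{N}_J}\}$ ($f_{\boldsymbol{N}_J}$ holomorphic on $S_{J'}$, constant when $J=\mathcal{N}$), $\mathrm{App}_{\boldsymbol{N}}(\mathcal{F})(\boldsymbol{z})=\sum_{\emptyset\ne J\subset\mathcal{N}}(-1)^{\#J+1}\sum_{\boldsymbol{H}_J<\boldsymbol{N}_J}f_{\boldsymbol{H}_J}(\boldsymbol{z}_{J'})\boldsymbol{z}_J^{\boldsymbol{H}_J}$. A holomorphic $F$ has $\mathcal{F}$ as (total) family of $\boldsymbol{1}$-Gevrey strong asymptotic expansion in $S$ if for every $T\prec S$ there are $c>0$, $\boldsymbol{A}\in(0,\infty)^n$ with $|F(\boldsymbol{z})-\mathrm{App}_{\boldsymbol{N}}(\mathcal{F})(\boldsymbol{z})|\le c\boldsymbol{A}^{\boldsymbol{N}}\boldsymbol{N}!|\boldsymbol{z}|^{\boldsymbol{N}}$ on $T$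 for all $\boldsymbol{N}$. It has type $\boldsymbol{R}'$ following multidirection $\boldsymbol{\theta}$ if for every $\delta>0$ there is $C_1$ with $|F(\boldsymbol{z})-\mathrm{App}_{\boldsymbol{N}}(\mathcal{F})(\boldsymbol{z})|\le C_1\prod_j(1/R'_j+\delta)^{N_j}\boldsymbol{N}!|\boldsymbol{z}|^{\boldsymbol{N}}$ for all $\boldsymbol{N}$ and all $\boldsymbol{z}\in S$ with $\arg\boldsymbol{z}=\boldsymbol{\theta}$. *)

theory Defs
  imports "HOL-Complex_Analysis.Complex_Analysis"
begin

text \<open>Conventions: the dimension is a natural number n, coordinates are indexed by
  {..<n} (i.e. 0..n-1 instead of 1..n). Points of C^n are functions nat => complex,
  multi-indices are functions nat => nat. A multi-index on an index set I is one
  vanishing outside I.\<close>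

definition mi :: "nat set \<Rightarrow> (nat \<Rightarrow> nat) set" where
  "mi I = {N. \<forall>j. j \<notin> I \<longrightarrow> N j = 0}"

definition sector :: "real \<Rightarrow> real \<Rightarrow> ereal \<Rightarrow> complex set" where
  "sector a b \<rho> = {z. 0 < cmod z \<and> ereal (cmod z) < \<rho> \<and>
      (\<exists>\<theta>. a < \<theta> \<and> \<theta> < b \<and> z = complex_of_real (cmod z) * cis \<theta>)}"

definition polysector :: "nat set \<Rightarrow> (nat \<Rightarrow> complex set) \<Rightarrow> (nat \<Rightarrow> complex) set" where
  "polysector I S = {z. (\<forall>j\<in>I. z j \<in> S j) \<and> (\<forall>j. j \<notin> I \<longrightarrow> z j = 0)}"

definition subpoly :: "nat \<Rightarrow> (nat \<Rightarrow> complex) set \<Rightarrow> (nat \<Rightarrow> complex set) \<Rightarrow> bool" where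
  "subpoly n T S \<longleftrightarrow> (\<exists>a b r. (\<forall>j<n. 0 < r j \<and>
        closure (sector (a j) (b j) (ereal (r j))) - {0} \<subseteq> S j) \<and>
      T = polysector {..<n} (\<lambda>j. sector (a j) (b j) (ereal (r j))))"

text \<open>Holomorphy in the coordinates I (separate holomorphy, equivalent by Hartogs).\<close>
definition sep_holo :: "nat set \<Rightarrow> (nat \<Rightarrow> complex) set \<Rightarrow> ((nat \<Rightarrow> complex) \<Rightarrow> complex) \<Rightarrow> bool" where
  "sep_holo I U G \<longleftrightarrow> (\<forall>z\<in>U. \<forall>j\<in>I. (\<lambda>w. G (z(j := w))) field_differentiable (at (z j)))"

text \<open>App_N of a family fam J H (fam J H depends only on the coordinates outside J).\<close>
definition App :: "nat \<Rightarrow> (nat set \<Rightarrow> (nat \<Rightarrow> nat) \<Rightarrow> (nat \<Rightarrow> complex) \<Rightarrow> complex)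
    \<Rightarrow> (nat \<Rightarrow> nat) \<Rightarrow> (nat \<Rightarrow> complex) \<Rightarrow> complex" where
  "App n fam N z = (\<Sum>J\<in>{J. J \<subseteq> {..<n} \<and> J \<noteq> {}}.
      (-1) ^ (card J + 1) * (\<Sum>H\<in>{H\<in>mi J. \<forall>j\<in>J. H j < N j}.
          fam J H z * (\<Prod>j\<in>J. z j ^ H j)))"

definition gevrey_sae :: "nat \<Rightarrow> ((nat \<Rightarrow> complex) \<Rightarrow> complex)
    \<Rightarrow> (nat set \<Rightarrow> (nat \<Rightarrow> nat) \<Rightarrow> (nat \<Rightarrow> complex) \<Rightarrow> complex) \<Rightarrow> (nat \<Rightarrow> complex set) \<Rightarrow> bool" where
  "gevrey_sae n F fam S \<longleftrightarrow>
     sep_holo {..<n} (polysector {..<n} S) F \<and>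
     (\<forall>J \<alpha>. J \<subseteq> {..<n} \<and> J \<noteq> {} \<and> J \<noteq> {..<n} \<and> \<alpha> \<in> mi J \<longrightarrow>
        sep_holo ({..<n} - J) (polysector ({..<n} - J) S) (fam J \<alpha>)) \<and>
     (\<forall>T. subpoly n T S \<longrightarrow>
        (\<exists>c>0. \<exists>A. (\<forall>j<n. A j > 0) \<and>
          (\<forall>N\<in>mi {..<n}. \<forall>z\<in>T.
             cmod (F z - App n fam N z)
               \<le> c * (\<Prod>j<n. A j ^ N j * fact (N j) * cmod (z j) ^ N j))))"

definition gevrey_type_dir :: "nat \<Rightarrow> ((nat \<Rightarrow> complex) \<Rightarrow> complex)
    \<Rightarrow> (nat set \<Rightarrow> (nat \<Rightarrow> nat) \<Rightarrow> (nat \<Rightarrow> complex) \<Rightarrow> complex) \<Rightarrow> (nat \<Rightarrow> complex set)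
    \<Rightarrow> (nat \<Rightarrow> real) \<Rightarrow> (nat \<Rightarrow> real) \<Rightarrow> bool" where
  "gevrey_type_dir n F fam S R' \<theta> \<longleftrightarrow>
     (\<forall>\<delta>>0. \<exists>C1. \<forall>N\<in>mi {..<n}. \<forall>z\<in>polysector {..<n} S.
        (\<forall>j<n. \<exists>\<rho>>0. z j = complex_of_real \<rho> * cis (\<theta> j)) \<longrightarrow>
        cmod (F z - App n fam N z)
          \<le> C1 * (\<Prod>j<n. (1 / R' j + \<delta>) ^ N j * fact (N j) * cmod (z j) ^ N j))"

fun iter_cint :: "nat list \<Rightarrow> (nat \<Rightarrow> complex) \<Rightarrow> ((nat \<Rightarrow> complex) \<Rightarrow> complex)
    \<Rightarrow> (nat \<Rightarrow> complex) \<Rightarrow> complex" where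
  "iter_cint [] z0 g t = g t"
| "iter_cint (j # js) z0 g t =
     contour_integral (linepath 0 (z0 j)) (\<lambda>w. iter_cint js z0 g (t(j := w)))"

text \<open>phi_{alpha_J}(t_{J'}) (for J = {} this is the Borel transform phi).\<close>
definition phiJ :: "nat \<Rightarrow> ((nat \<Rightarrow> nat) \<Rightarrow> complex) \<Rightarrow> nat set \<Rightarrow> (nat \<Rightarrow> nat)
    \<Rightarrow> (nat \<Rightarrow> complex) \<Rightarrow> complex" where
  "phiJ n f J \<alpha> t = infsum (\<lambda>\<beta>. f (\<lambda>j. \<alpha> j + \<beta> j) *
       (\<Prod>j\<in>{..<n} - J. t j ^ \<beta> j / of_nat (fact (\<beta> j)))) (mi ({..<n} - J))"

definition FJ :: "nat \<Rightarrow> ((nat \<Rightarrow> nat) \<Rightarrow> complex) \<Rightarrow> (nat \<Rightarrow> complex) \<Rightarrow> nat set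
    \<Rightarrow> (nat \<Rightarrow> nat) \<Rightarrow> (nat \<Rightarrow> complex) \<Rightarrow> complex" where
  "FJ n f z0 J \<alpha> z = inverse (\<Prod>j\<in>{..<n} - J. z j) *
     iter_cint (sorted_list_of_set ({..<n} - J)) z0
       (\<lambda>t. phiJ n f J \<alpha> t * exp (- (\<Sum>j\<in>{..<n} - J. t j / z j))) (\<lambda>_. 0)"

definition Fborel :: "nat \<Rightarrow> ((nat \<Rightarrow> nat) \<Rightarrow> complex) \<Rightarrow> (nat \<Rightarrow> complex) \<Rightarrow> (nat \<Rightarrow> complex) \<Rightarrow> complex" where
  "Fborel n f z0 = FJ n f z0 {} (\<lambda>_. 0)"

definition famF :: "nat \<Rightarrow> ((nat \<Rightarrow> nat) \<Rightarrow> complex) \<Rightarrow> (nat \<Rightarrow> complex)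
    \<Rightarrow> nat set \<Rightarrow> (nat \<Rightarrow> nat) \<Rightarrow> (nat \<Rightarrow> complex) \<Rightarrow> complex" where
  "famF n f z0 J \<alpha> z = (if J = {..<n} then f \<alpha> else FJ n f z0 J \<alpha> z)"

definition S0 :: "(nat \<Rightarrow> complex) \<Rightarrow> nat \<Rightarrow> complex set" where
  "S0 z0 j = sector (Arg (z0 j) - pi / 2) (Arg (z0 j) + pi / 2) \<infinity>"

end

theory Submission
  imports Defs
begin

text \<open>Write \<open>L a k z\<close> for \<open>z\<inverse>\<close> times the integral of \<open>(t ^ k / k!) exp (- t / z)\<close> over the segment
  from \<open>0\<close> to \<open>a\<close>. Integrating the power series termwise gives \<open>F\<close> and every member of the family as a
  series of products of such factors, and by inclusion-exclusion the remainder factorises: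
  \<open>F z - App N z\<close> is the sum over \<open>\<beta>\<close> of
  \<open>f \<beta>\<close> times the product over \<open>j\<close> of \<open>L (z0 j) (\<beta> j) (z j) - [\<beta> j < N j] z j ^ \<beta> j\<close>.
  For \<open>k \<ge> N\<close> the bound \<open>|t| ^ k \<le> |a| ^ (k - N) |t| ^ N\<close> holds on the segment, and for \<open>k < N\<close> it holds
  on the rest of the ray, over which the integral of \<open>(t ^ k / k!) exp (- t / z)\<close> is
  \<open>z (z ^ k - L a k z)\<close>. Both cases therefore
  give the same estimate \<open>|a| ^ k / k! * N! |z| ^ N / (|a| ^ N c ^ (N + 1))\<close> with
  \<open>c = cos (arg z - arg a)\<close>. Summing over \<open>\<beta>\<close> leaves a finite constant because \<open>|z0 j| < R j\<close>.\<close>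

subsection \<open>Truncated Laplace transforms of monomials\<close>

text \<open>The normalisation makes the same integral over the full ray through \<open>a\<close>
  equal to \<open>z ^ k\<close> when \<open>Re (a / z) > 0\<close>.\<close>

definition lap :: "complex \<Rightarrow> nat \<Rightarrow> complex \<Rightarrow> complex" where
  "lap a k z = inverse z *
     contour_integral (linepath 0 a) (\<lambda>t. t ^ k / of_nat (fact k) * exp (- (t / z)))"

text \<open>The polynomial is what \<open>k\<close> integrations by parts produce. The general field
  lets one primitive serve complex segments and the real unit interval.\<close>

lemma DERIV_exp_minus_mult_powers:
  fixes z :: "'a :: {real_normed_field, banach}"
  assumes "z \<noteq> 0"
  shows "((\<lambda>t. - exp (- (t / z)) * (\<Sum>i\<le>k. t ^ i * z ^ (k - i) / fact i))
           has_field_derivative t ^ k / fact k * exp (- (t / z)) / z) (at t within A)"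
proof (induction k)
  case 0
  show ?case
    using assms by (auto intro!: derivative_eq_intros)
next
  case (Suc k)
  have split: "- exp (- (s / z)) * (\<Sum>i\<le>Suc k. s ^ i * z ^ (Suc k - i) / fact i) =
      z * (- exp (- (s / z)) * (\<Sum>i\<le>k. s ^ i * z ^ (k - i) / fact i))
      - exp (- (s / z)) * (s ^ Suc k / fact (Suc k))" for s
  proof -
    have "(\<Sum>i\<le>k. s ^ i * z ^ (Suc k - i) / fact i) = z * (\<Sum>i\<le>k. s ^ i * z ^ (k - i) / fact i)"
      unfolding sum_distrib_left by (rule sum.cong) (auto simp: Suc_diff_le)
    then show ?thesis
      by (simp add: algebra_simps)
  qed
  have pow: "((\<lambda>s. s ^ Suc k / fact (Suc k)) has_field_derivative t ^ k / fact k) (at t within A)"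
    using DERIV_cdivide[OF DERIV_power[OF DERIV_ident, of "Suc k"], of "fact (Suc k)"]
    by (simp del: of_nat_Suc)
  have ex: "((\<lambda>s. exp (- (s / z))) has_field_derivative - (exp (- (t / z)) / z)) (at t within A)"
    using assms by (auto intro!: derivative_eq_intros)
  \<comment> \<open>The derivative of the new power contributes
    \<open>- exp (- (t / z)) * t ^ k / fact k\<close>, which cancels \<open>z\<close> times the old
    integrand.\<close>
  show ?case
    unfolding split
    by (rule DERIV_cong[OF DERIV_diff[OF DERIV_cmult[OF Suc.IH] DERIV_mult[OF ex pow]]])
       (use assms in \<open>simp add: divide_inverse algebra_simps\<close>)
qed

lemma lap_closed_form:
  assumes "z \<noteq> 0"
  shows "lap a k z = z ^ k - exp (- (a / z)) * (\<Sum>i\<le>k. a ^ i * z ^ (k - i) / fact i)"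
proof -
  let ?P = "\<lambda>t. - exp (- (t / z)) * (\<Sum>i\<le>k. t ^ i * z ^ (k - i) / fact i)"
  have "((\<lambda>t. t ^ k / fact k * exp (- (t / z)) / z) has_contour_integral
          (?P (pathfinish (linepath 0 a)) - ?P (pathstart (linepath 0 a)))) (linepath 0 a)"
    by (rule contour_integral_primitive[where S = UNIV])
       (rule DERIV_exp_minus_mult_powers[OF assms] valid_path_linepath subset_UNIV)+
  then have "((\<lambda>t. z * (t ^ k / fact k * exp (- (t / z)) / z)) has_contour_integral
          z * (?P a - ?P 0)) (linepath 0 a)"
    by (intro has_contour_integral_lmul) auto
  then have "((\<lambda>t. t ^ k / of_nat (fact k) * exp (- (t / z))) has_contour_integral
          z * (?P a - ?P 0)) (linepath 0 a)"
    using assms by simp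
  then have "lap a k z = ?P a - ?P 0"
    using assms by (simp add: lap_def contour_integral_unique)
  \<comment> \<open>At the origin only \<open>i = 0\<close> survives, with
    \<open>0 ^ 0 = 1\<close>.\<close>
  moreover have "(\<Sum>i\<le>k. 0 ^ i * z ^ (k - i) / fact i) = z ^ k"
    using sum.delta[of "{..k}" 0 "\<lambda>i. z ^ (k - i) / fact i"]
    by (simp add: power_0_left if_distrib[of "\<lambda>x. x * _"] if_distrib[of "\<lambda>x. x / _"] cong: if_cong)
  ultimately show ?thesis
    by simp
qed

text \<open>The closed form makes the dependence on \<open>z\<close> explicit, which avoids
  differentiating under the integral sign.\<close>

lemma holomorphic_lap:
  "lap a k holomorphic_on - {0}"
proof -
  have "(\<lambda>z. z ^ k - exp (- (a / z)) * (\<Sum>i\<le>k. a ^ i * z ^ (k - i) / fact i))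
          holomorphic_on - {0}"
    by (intro holomorphic_intros) auto
  then show ?thesis
    by (rule holomorphic_transform) (simp add: lap_closed_form)
qed

text \<open>In the primitive above, taken with \<open>z = 1 / y\<close>, the value at
  \<open>1\<close> is nonpositive and is dropped; what remains is the moment over the whole
  half-line.\<close>

lemma integral_power_exp_le:
  fixes y :: real
  assumes "y > 0"
  shows "integral {0..1} (\<lambda>u. u ^ N * exp (- (u * y))) \<le> fact N / y ^ Suc N"
proof -
  define x where "x = 1 / y"
  have x: "x > 0" and y: "u / x = u * y" for u
    using assms by (auto simp: x_def)
  have y': "fact N * x * (u ^ N / fact N * exp (- (u / x)) / x) = u ^ N * exp (- (u * y))" for u
    using x by (simp flip: y)
  let ?P = "\<lambda>t. - exp (- (t / x)) * (\<Sum>i\<le>N. t ^ i * x ^ (N - i) / fact i)"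
  have "((\<lambda>t. t ^ N / fact N * exp (- (t / x)) / x) has_integral (?P 1 - ?P 0)) {0..1}"
    by (rule fundamental_theorem_of_calculus)
       (use DERIV_exp_minus_mult_powers[of x N] x in
         \<open>auto simp: has_real_derivative_iff_has_vector_derivative[symmetric]\<close>)
  then have "((\<lambda>t. (fact N * x) * (t ^ N / fact N * exp (- (t / x)) / x))
      has_integral (fact N * x) * (?P 1 - ?P 0)) {0..1}"
    by (intro has_integral_mult_right)
  then have "((\<lambda>u. u ^ N * exp (- (u * y))) has_integral (fact N * x) * (?P 1 - ?P 0)) {0..1}"
    unfolding y' .
  then have "integral {0..1} (\<lambda>u. u ^ N * exp (- (u * y))) = (fact N * x) * (?P 1 - ?P 0)"
    by (rule integral_unique)
  also have "?P 0 = - (x ^ N)"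
    using sum.delta[of "{..N}" 0 "\<lambda>i. x ^ (N - i) / fact i"]
    by (simp add: power_0_left if_distrib[of "\<lambda>x. x * _"] if_distrib[of "\<lambda>x. x / _"] cong: if_cong)
  also have "?P 1 \<le> 0"
    using x by (simp add: sum_nonneg)
  then have "(fact N * x) * (?P 1 - - (x ^ N)) \<le> (fact N * x) * (x ^ N)"
    using x by (intro mult_left_mono) auto
  also have "\<dots> = fact N / y ^ Suc N"
    by (simp add: x_def power_divide)
  finally show ?thesis .
qed

lemma norm_power_exp_le_segment:
  fixes a z :: complex
  assumes "t \<in> closed_segment 0 a"
  shows "norm (t ^ k / of_nat (fact k) * exp (- (t / z)))
           \<le> norm a ^ k / fact k * exp (norm a / norm z)"
proof -
  have t: "norm t \<le> norm a"
    using segment_bound1[OF assms] by simp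
  have "norm (exp (- (t / z))) \<le> exp (norm (- (t / z)))"
    by (rule norm_exp)
  also have "\<dots> \<le> exp (norm a / norm z)"
    using t by (simp add: norm_divide divide_right_mono)
  finally have "norm (exp (- (t / z))) \<le> exp (norm a / norm z)" .
  moreover have "norm (t ^ k / of_nat (fact k)) \<le> norm a ^ k / fact k"
    using t by (simp add: norm_divide norm_power divide_right_mono power_mono)
  ultimately show ?thesis
    unfolding norm_mult by (intro mult_mono) auto
qed

text \<open>The dependence on \<open>k\<close> is confined to \<open>norm a ^ k / fact k\<close>,
  the weight under which the coefficients are summable. At \<open>z = 0\<close> both sides vanish,
  since \<open>inverse 0 = 0\<close>.\<close>

lemma norm_lap_le_crude:
  "norm (lap a k z) \<le> norm a ^ k / fact k * (norm a * exp (norm a / norm z) / norm z)"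
proof -
  have "norm (contour_integral (linepath 0 a) (\<lambda>t. t ^ k / of_nat (fact k) * exp (- (t / z))))
          \<le> norm a ^ k / fact k * exp (norm a / norm z) * norm (a - 0)"
    unfolding divide_inverse
    by (intro contour_integral_bound_linepath contour_integrable_continuous_linepath
          continuous_intros norm_power_exp_le_segment[unfolded divide_inverse]) auto
  then have "norm (inverse z) * norm (contour_integral (linepath 0 a) (\<lambda>t. t ^ k / of_nat (fact k) * exp (- (t / z))))
          \<le> norm (inverse z) * (norm a ^ k / fact k * exp (norm a / norm z) * norm (a - 0))"
    by (rule mult_left_mono) auto
  then show ?thesis
    by (simp add: lap_def norm_mult norm_inverse divide_inverse mult_ac)
qed

subsection \<open>Remainder estimates in one variable\<close>

text \<open>The quotient \<open>fact (i + m) / fact i\<close> is a product of \<open>m\<close>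
  consecutive integers starting at \<open>i + 1\<close>, hence grows with \<open>i\<close>.\<close>

lemma fact_mult_fact_add_le:
  assumes "i \<le> k"
  shows "fact k * fact (i + m) \<le> (fact i * fact (k + m) :: nat)"
proof (induction m)
  case (Suc m)
  have "fact k * fact (i + Suc m) = Suc (i + m) * (fact k * fact (i + m) :: nat)"
    by (simp only: add_Suc_right fact_Suc of_nat_id mult_ac)
  also have "\<dots> \<le> Suc (k + m) * (fact i * fact (k + m))"
    using assms by (intro mult_mono Suc.IH) auto
  also have "\<dots> = fact i * fact (k + Suc m)"
    by (simp only: add_Suc_right fact_Suc of_nat_id mult_ac)
  finally show ?case .
qed simp

lemma sum_powers_shift_le_exp:
  fixes x :: real
  assumes "x \<ge> 0"
  shows "(\<Sum>i\<le>k. x ^ (i + m) / fact (i + m)) \<le> exp x"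
proof -
  have "(\<Sum>i\<le>k. x ^ (i + m) / fact (i + m)) = (\<Sum>i\<in>(\<lambda>i. i + m) ` {..k}. x ^ i / fact i)"
    by (subst sum.reindex) auto
  also have "\<dots> \<le> (\<Sum>i. x ^ i / fact i)"
    using assms exp_converges[of x]
    by (intro sum_le_suminf) (auto simp: sums_iff divide_inverse mult.commute)
  also have "\<dots> = exp x"
    using exp_converges[of x] by (simp add: sums_iff divide_inverse mult.commute)
  finally show ?thesis .
qed

text \<open>For nonzero \<open>a\<close> the hypothesis says that \<open>\<kappa>\<close> is at most
  the cosine of the angle between \<open>a\<close> and \<open>z\<close>, without mentioning
  arguments.\<close>

lemma Re_divide_ge:
  assumes "z \<noteq> 0" "\<kappa> * norm a * norm z \<le> Re (z * cnj a)"
  shows "\<kappa> * (norm a / norm z) \<le> Re (a / z)"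
proof -
  have "Re (a / z) = Re (z * cnj a) / (norm z)\<^sup>2"
    unfolding complex_div_cnj[of a z] by (simp add: algebra_simps flip: of_real_power)
  also have "\<dots> \<ge> \<kappa> * norm a * norm z / (norm z)\<^sup>2"
    using assms by (intro divide_right_mono) auto
  finally show ?thesis
    using assms by (simp add: power2_eq_square)
qed

text \<open>On \<open>t = u * a\<close> with \<open>0 \<le> u \<le> 1\<close>, lowering the exponent
  from \<open>k\<close> to \<open>N\<close> only enlarges \<open>u ^ k\<close>, and the exponential
  decays at rate at least \<open>y\<close>. What is left is the moment bound for
  \<open>u ^ N\<close>.\<close>

lemma norm_lap_le:
  assumes "a \<noteq> 0" "z \<noteq> 0" "\<kappa> > 0" and \<kappa>: "\<kappa> * norm a * norm z \<le> Re (z * cnj a)"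
    and "N \<le> k"
  shows "norm (lap a k z) \<le> norm a ^ k / fact k * (fact N * norm z ^ N / (norm a ^ N * \<kappa> ^ Suc N))"
proof -
  define y where "y = \<kappa> * (norm a / norm z)"
  have y: "y > 0" and Re: "y \<le> Re (a / z)"
    using assms Re_divide_ge[OF _ \<kappa>] by (auto simp: y_def)
  let ?f = "\<lambda>t. t ^ k / of_nat (fact k) * exp (- (t / z))"
  have "continuous_on {0..1} (\<lambda>u. ?f (of_real u * a) * a)"
    by (auto intro!: continuous_intros simp: assms)
  then have int1: "(\<lambda>u. ?f (of_real u * a) * a) integrable_on {0..1}"
    by (rule integrable_continuous_real)
  have "continuous_on {0..1::real} (\<lambda>u. norm a ^ Suc k / fact k * (u ^ N * exp (- (u * y))))"
    by (auto intro!: continuous_intros)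
  then have int2: "(\<lambda>u. norm a ^ Suc k / fact k * (u ^ N * exp (- (u * y)))) integrable_on {0..1::real}"
    by (rule integrable_continuous_real)
  have "contour_integral (linepath 0 a) ?f = integral {0..1} (\<lambda>u. ?f (of_real u * a) * a)"
    by (simp add: contour_integral_integral linepath_def scaleR_conv_of_real vector_derivative_linepath_at)
  also have "norm \<dots> \<le> integral {0..1} (\<lambda>u. norm a ^ Suc k / fact k * (u ^ N * exp (- (u * y))))"
  proof (rule integral_norm_bound_integral[OF int1 int2])
    fix u :: real assume u: "u \<in> {0..1}"
    have "u * y \<le> u * Re (a / z)"
      using u Re by (intro mult_left_mono) auto
    then have "u ^ k * exp (- (u * Re (a / z))) \<le> u ^ N * exp (- (u * y))"
      using u \<open>N \<le> k\<close> by (intro mult_mono power_decreasing) auto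
    then have "norm a ^ Suc k / fact k * (u ^ k * exp (- (u * Re (a / z))))
        \<le> norm a ^ Suc k / fact k * (u ^ N * exp (- (u * y)))"
      by (intro mult_left_mono) auto
    moreover have "Re (of_real u * a / z) = u * Re (a / z)"
      by (metis Re_complex_of_real scaleR_complex.sel(1) scaleR_conv_of_real times_divide_eq_right)
    then have "norm (?f (of_real u * a) * a) = norm a ^ Suc k / fact k * (u ^ k * exp (- (u * Re (a / z))))"
      using u by (simp add: norm_mult norm_divide norm_power power_mult_distrib)
    ultimately show "norm (?f (of_real u * a) * a)
        \<le> norm a ^ Suc k / fact k * (u ^ N * exp (- (u * y)))"
      by simp
  qed
  also have "\<dots> = norm a ^ Suc k / fact k * integral {0..1} (\<lambda>u. u ^ N * exp (- (u * y)))"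
    by simp
  also have "\<dots> \<le> norm a ^ Suc k / fact k * (fact N / y ^ Suc N)"
    by (intro mult_left_mono integral_power_exp_le y) auto
  finally have "norm (inverse z) * norm (contour_integral (linepath 0 a) ?f)
      \<le> norm (inverse z) * (norm a ^ Suc k / fact k * (fact N / y ^ Suc N))"
    by (intro mult_left_mono) auto
  also have "\<dots> = norm a ^ k / fact k * (fact N * norm z ^ N / (norm a ^ N * \<kappa> ^ Suc N))"
    using assms unfolding y_def norm_inverse by (simp add: power_mult_distrib power_divide divide_simps)
  finally show ?thesis
    by (simp add: lap_def norm_mult)
qed

text \<open>For \<open>k < N\<close> the closed form of \<open>z ^ k - lap a k z\<close> replaces the improper integral over the rest
  of the ray: its terms are compared with those of the series of \<open>exp y\<close>.\<close>

lemma norm_lap_minus_power_le: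
  assumes "a \<noteq> 0" "z \<noteq> 0" "\<kappa> > 0" and \<kappa>: "\<kappa> * norm a * norm z \<le> Re (z * cnj a)"
  shows "norm (lap a k z - (if k < N then z ^ k else 0))
           \<le> norm a ^ k / fact k * (fact N * norm z ^ N / (norm a ^ N * \<kappa> ^ Suc N))"
proof (cases "k < N")
  case False
  then show ?thesis
    using norm_lap_le[OF assms] by simp
next
  case True
  define m where "m = N - k"
  have N: "N = k + m"
    using True by (simp add: m_def)
  define y where "y = \<kappa> * (norm a / norm z)"
  have y: "y > 0" and Re: "y \<le> Re (a / z)"
    using assms Re_divide_ge[OF _ \<kappa>] by (auto simp: y_def)
  \<comment> \<open>As a lower bound for a cosine, \<open>\<kappa>\<close> is at most
    \<open>1\<close>, so powers of \<open>1 / \<kappa>\<close> can be inserted below.\<close>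
  have "\<kappa> * norm (z * cnj a) \<le> 1 * norm (z * cnj a)"
    using \<kappa> complex_Re_le_cmod[of "z * cnj a"] by (simp add: norm_mult mult_ac)
  then have \<kappa>1: "\<kappa> \<le> 1"
    using assms by simp
  define B where "B = norm a ^ k / fact k * (fact N * norm z ^ N / (norm a ^ N * \<kappa> ^ Suc N))"
  have B: "B \<ge> 0"
    unfolding B_def using assms by simp
  \<comment> \<open>The index shift \<open>m\<close> is chosen to fit \<open>B\<close>:
    \<open>y ^ (i + m)\<close> cancels all of \<open>\<kappa> ^ Suc N\<close> in the denominator
    except \<open>\<kappa> ^ Suc (k - i)\<close>.\<close>
  have term_le: "norm a ^ i * norm z ^ (k - i) / fact i \<le> B * (y ^ (i + m) / fact (i + m))"
    if ik: "i \<le> k" for i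
  proof -
    obtain d where k: "k = i + d"
      using ik le_Suc_ex by blast
    have "real (fact k * fact (i + m)) \<le> real (fact i * fact N)"
      unfolding N using fact_mult_fact_add_le[OF ik] by (rule of_nat_mono)
    then have "1 / fact i \<le> (fact N / (fact k * fact (i + m)) :: real)"
      by (simp add: field_simps)
    also have "\<dots> \<le> fact N / (fact k * fact (i + m)) / \<kappa> ^ Suc d"
      using assms \<kappa>1 by (simp add: le_divide_eq mult_left_le power_le_one del: power_Suc)
    finally have "norm a ^ i * norm z ^ d * (1 / fact i)
        \<le> norm a ^ i * norm z ^ d * (fact N / (fact k * fact (i + m)) / \<kappa> ^ Suc d)"
      by (rule mult_left_mono) auto
    also have "\<dots> = B * (y ^ (i + m) / fact (i + m))"
      using assms unfolding B_def y_def N k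
      by (simp add: power_mult_distrib power_divide power_add field_simps)
    finally show ?thesis
      by (simp add: k)
  qed
  have "norm (lap a k z - z ^ k)
      = norm (exp (- (a / z))) * norm (\<Sum>i\<le>k. a ^ i * z ^ (k - i) / fact i)"
    using assms by (simp add: lap_closed_form norm_mult)
  also have "\<dots> \<le> exp (- y) * (\<Sum>i\<le>k. norm a ^ i * norm z ^ (k - i) / fact i)"
    using Re by (intro mult_mono order.trans[OF norm_sum])
      (auto simp: norm_mult norm_power norm_divide sum_nonneg)
  also have "\<dots> \<le> exp (- y) * (\<Sum>i\<le>k. B * (y ^ (i + m) / fact (i + m)))"
    using term_le by (intro mult_left_mono sum_mono) auto
  \<comment> \<open>The shifted terms sum to at most \<open>exp y\<close>, which the decay
    \<open>exp (- y)\<close> cancels exactly.\<close>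
  also have "\<dots> \<le> exp (- y) * (B * exp y)"
    unfolding sum_distrib_left[symmetric]
    using y B by (intro mult_left_mono sum_powers_shift_le_exp) auto
  also have "\<dots> = B"
    by (simp add: exp_minus field_simps)
  finally show ?thesis
    using True by (simp add: B_def)
qed

subsection \<open>Sums over multi-indices\<close>

text \<open>Disjoint supports turn pointwise addition into gluing.\<close>

lemma bij_betw_mi:
  assumes "J \<subseteq> I"
  shows "bij_betw (\<lambda>(\<alpha>, \<beta>) j. \<alpha> j + \<beta> j) (mi J \<times> mi (I - J)) (mi I)"
proof (rule bij_betw_byWitness[where
      f' = "\<lambda>\<gamma>. (\<lambda>j. if j \<in> J then \<gamma> j else 0, \<lambda>j. if j \<in> J then 0 else \<gamma> j)"])
qed (use assms in \<open>auto simp: mi_def fun_eq_iff\<close>)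

text \<open>A finite set of multi-indices lies in a box, over which the sum of products is a product
  of sums, each below the full series of its coordinate.\<close>

lemma summable_on_mi_prod:
  fixes h :: "nat \<Rightarrow> nat \<Rightarrow> real"
  assumes "finite I" "\<And>j k. j \<in> I \<Longrightarrow> h j k \<ge> 0" "\<And>j. j \<in> I \<Longrightarrow> summable (h j)"
  shows "(\<lambda>\<beta>. \<Prod>j\<in>I. h j (\<beta> j)) summable_on mi I"
proof (rule nonneg_bdd_above_summable_on)
  show "bdd_above (sum (\<lambda>\<beta>. \<Prod>j\<in>I. h j (\<beta> j)) ` {F. F \<subseteq> mi I \<and> finite F})"
  proof (rule bdd_aboveI2)
    fix F assume "F \<in> {F. F \<subseteq> mi I \<and> finite F}"
    then have F: "F \<subseteq> mi I" "finite F"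
      by auto
    define K where "K j = (\<lambda>\<beta>. \<beta> j) ` F" for j
    have fin: "finite (K j)" for j
      using F by (simp add: K_def)
    \<comment> \<open>Elements of \<open>Pi\<^sub>E I K\<close> are \<open>undefined\<close> outside
      \<open>I\<close>, while multi-indices vanish there; \<open>restrict\<close> passes injectively
      from the latter to the former.\<close>
    have "(\<Sum>\<beta>\<in>F. \<Prod>j\<in>I. h j (\<beta> j)) = (\<Sum>\<beta>\<in>(\<lambda>\<beta>. restrict \<beta> I) ` F. \<Prod>j\<in>I. h j (\<beta> j))"
    proof (subst sum.reindex)
      show "inj_on (\<lambda>\<beta>. restrict \<beta> I) F"
      proof (rule inj_onI, rule ext)
        fix \<beta> \<gamma> j assume "\<beta> \<in> F" "\<gamma> \<in> F" and eq: "restrict \<beta> I = restrict \<gamma> I"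
        then have "\<beta> \<in> mi I" "\<gamma> \<in> mi I"
          using F by auto
        then show "\<beta> j = \<gamma> j"
          using fun_cong[OF eq, of j] by (cases "j \<in> I") (auto simp: mi_def)
      qed
    qed auto
    also have "\<dots> \<le> (\<Sum>\<beta>\<in>Pi\<^sub>E I K. \<Prod>j\<in>I. h j (\<beta> j))"
      using assms fin by (intro sum_mono2 finite_PiE prod_nonneg) (auto simp: K_def)
    also have "\<dots> = (\<Prod>j\<in>I. \<Sum>k\<in>K j. h j k)"
      using assms fin by (simp add: prod_sum_PiE)
    also have "\<dots> \<le> (\<Prod>j\<in>I. suminf (h j))"
      using assms fin by (intro prod_mono conjI sum_nonneg sum_le_suminf) auto
    finally show "(\<Sum>\<beta>\<in>F. \<Prod>j\<in>I. h j (\<beta> j)) \<le> (\<Prod>j\<in>I. suminf (h j))" .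
  qed
qed (use assms in \<open>auto intro: prod_nonneg\<close>)

section \<open>Summability of Gevrey coefficients inside the polydisc\<close>

lemma exists_common_delta:
  fixes R \<rho> :: "nat \<Rightarrow> real"
  assumes "\<forall>j<n. R j > 0 \<and> 0 < \<rho> j \<and> \<rho> j < R j"
  shows "\<exists>\<delta>>0. \<forall>j<n. (1 / R j + \<delta>) * \<rho> j < 1"
  using assms
proof (induction n)
  case (Suc n)
  then obtain d where d: "d > 0" "\<forall>j<n. (1 / R j + d) * \<rho> j < 1"
    by auto
  have pos: "0 < 1 / \<rho> n - 1 / R n"
    using Suc.prems by (simp add: frac_less2)
  \<comment> \<open>The upper bound on \<open>e\<close> is
    \<open>(1 / R n + e) * \<rho> n < 1\<close> solved for \<open>e\<close>.\<close>
  then obtain e where e: "0 < e" "e < 1 / \<rho> n - 1 / R n"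
    using dense by blast
  have "(1 / R j + min d e) * \<rho> j < 1" if "j < Suc n" for j
  proof (cases "j = n")
    case True
    have "(1 / R n + min d e) * \<rho> n < (1 / \<rho> n) * \<rho> n"
      using e Suc.prems by (intro mult_strict_right_mono) auto
    then show ?thesis
      using True Suc.prems by auto
  next
    case False
    then have "(1 / R j + min d e) * \<rho> j \<le> (1 / R j + d) * \<rho> j"
      using that Suc.prems by (intro mult_right_mono) (auto simp: less_imp_le)
    also have "\<dots> < 1"
      using d False that by auto
    finally show ?thesis .
  qed
  then show ?case
    using d e by (intro exI[of _ "min d e"]) auto
qed (auto intro: exI[of _ 1])

text \<open>The factorials of the Gevrey bound cancel \<open>fact (\<beta> j)\<close> and leave a
  product of geometric series with ratios \<open>q j * \<rho> j < 1\<close>; the coordinates in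
  \<open>J\<close> only contribute to the constant \<open>D\<close>.\<close>

lemma summable_gevrey:
  fixes f :: "(nat \<Rightarrow> nat) \<Rightarrow> complex"
  assumes R_pos: "\<forall>j<n. R j > 0"
    and gevrey: "\<forall>\<delta>>0. \<exists>C>0. \<forall>N\<in>mi {..<n}.
        cmod (f N) \<le> C * (\<Prod>j<n. fact (N j) * (1 / R j + \<delta>) ^ N j)"
    and \<rho>: "\<forall>j<n. 0 < \<rho> j \<and> \<rho> j < R j"
    and J: "J \<subseteq> {..<n}" "\<alpha> \<in> mi J"
  shows "(\<lambda>\<beta>. cmod (f (\<lambda>j. \<alpha> j + \<beta> j)) * (\<Prod>j\<in>{..<n} - J. \<rho> j ^ \<beta> j / fact (\<beta> j)))
           summable_on mi ({..<n} - J)"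
proof -
  obtain \<delta> where \<delta>: "\<delta> > 0" "\<forall>j<n. (1 / R j + \<delta>) * \<rho> j < 1"
    using exists_common_delta[of n R \<rho>] R_pos \<rho> by blast
  obtain C where C: "C > 0" "\<And>N. N \<in> mi {..<n} \<Longrightarrow>
      cmod (f N) \<le> C * (\<Prod>j<n. fact (N j) * (1 / R j + \<delta>) ^ N j)"
    using gevrey \<delta>(1) by blast
  define q where "q j = 1 / R j + \<delta>" for j
  have q: "q j > 0" "q j * \<rho> j < 1" if "j < n" for j
    using that R_pos \<delta> by (auto simp: q_def add_pos_pos)
  let ?I = "{..<n} - J"
  define D where "D = C * (\<Prod>j\<in>J. fact (\<alpha> j) * q j ^ \<alpha> j)"
  have "(\<lambda>\<beta>. D * (\<Prod>j\<in>?I. (q j * \<rho> j) ^ \<beta> j)) summable_on mi ?I"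
    using q \<rho> by (intro summable_on_cmult_right summable_on_mi_prod summable_geometric)
      (auto simp: less_imp_le)
  then show ?thesis
  proof (rule summable_on_comparison_test)
    fix \<beta> assume \<beta>: "\<beta> \<in> mi ?I"
    have "(\<lambda>j. \<alpha> j + \<beta> j) \<in> mi {..<n}"
      using J \<beta> by (auto simp: mi_def)
    then have "cmod (f (\<lambda>j. \<alpha> j + \<beta> j)) \<le> C * (\<Prod>j<n. fact (\<alpha> j + \<beta> j) * q j ^ (\<alpha> j + \<beta> j))"
      unfolding q_def by (rule C(2))
    also have "(\<Prod>j<n. fact (\<alpha> j + \<beta> j) * q j ^ (\<alpha> j + \<beta> j))
        = (\<Prod>j\<in>?I. fact (\<alpha> j + \<beta> j) * q j ^ (\<alpha> j + \<beta> j)) * (\<Prod>j\<in>J. fact (\<alpha> j + \<beta> j) * q j ^ (\<alpha> j + \<beta> j))"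
      using J by (intro prod.subset_diff) auto
    also have "(\<Prod>j\<in>?I. fact (\<alpha> j + \<beta> j) * q j ^ (\<alpha> j + \<beta> j)) = (\<Prod>j\<in>?I. fact (\<beta> j) * q j ^ \<beta> j)"
      using J by (intro prod.cong) (auto simp: mi_def)
    also have "(\<Prod>j\<in>J. fact (\<alpha> j + \<beta> j) * q j ^ (\<alpha> j + \<beta> j)) = (\<Prod>j\<in>J. fact (\<alpha> j) * q j ^ \<alpha> j)"
      using \<beta> by (intro prod.cong) (auto simp: mi_def)
    finally have "cmod (f (\<lambda>j. \<alpha> j + \<beta> j)) \<le> D * (\<Prod>j\<in>?I. fact (\<beta> j) * q j ^ \<beta> j)"
      by (simp add: D_def mult_ac)
    then have "cmod (f (\<lambda>j. \<alpha> j + \<beta> j)) * (\<Prod>j\<in>?I. \<rho> j ^ \<beta> j / fact (\<beta> j))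
      \<le> D * (\<Prod>j\<in>?I. fact (\<beta> j) * q j ^ \<beta> j) * (\<Prod>j\<in>?I. \<rho> j ^ \<beta> j / fact (\<beta> j))"
      using \<rho> by (intro mult_right_mono prod_nonneg) (auto simp: less_imp_le)
    also have "\<dots> = D * (\<Prod>j\<in>?I. (q j * \<rho> j) ^ \<beta> j)"
      by (simp add: mult.assoc power_mult_distrib flip: prod.distrib)
    finally show "cmod (f (\<lambda>j. \<alpha> j + \<beta> j)) * (\<Prod>j\<in>?I. \<rho> j ^ \<beta> j / fact (\<beta> j))
      \<le> D * (\<Prod>j\<in>?I. (q j * \<rho> j) ^ \<beta> j)" .
  qed (use \<rho> in \<open>auto intro!: mult_nonneg_nonneg prod_nonneg simp: less_imp_le\<close>)
qed

subsection \<open>Termwise iterated integration\<close>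

text \<open>By the Weierstrass test the finite partial sums converge uniformly along the net of
  finite subsets of \<open>B\<close>, and integration over a fixed segment commutes with uniform
  limits.\<close>

lemma contour_integral_infsum_linepath:
  fixes g :: "'i \<Rightarrow> complex \<Rightarrow> complex"
  assumes cont: "\<And>i. i \<in> B \<Longrightarrow> continuous_on (closed_segment a b) (g i)"
    and bound: "\<And>i w. i \<in> B \<Longrightarrow> w \<in> closed_segment a b \<Longrightarrow> norm (g i w) \<le> M i"
    and M: "M summable_on B"
  shows "contour_integral (linepath a b) (\<lambda>w. \<Sum>\<^sub>\<infinity>i\<in>B. g i w)
           = (\<Sum>\<^sub>\<infinity>i\<in>B. contour_integral (linepath a b) (g i))"
proof -
  let ?F = "finite_subsets_at_top B"
  have ig: "g i contour_integrable_on linepath a b" if "i \<in> B" for i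
    by (intro contour_integrable_continuous_linepath cont that)
  have ev: "eventually (\<lambda>X. finite X \<and> X \<subseteq> B) ?F"
    by (simp add: eventually_finite_subsets_at_top_weakI)
  have "((\<lambda>X. contour_integral (linepath a b) (\<lambda>w. \<Sum>i\<in>X. g i w))
           \<longlongrightarrow> contour_integral (linepath a b) (\<lambda>w. \<Sum>\<^sub>\<infinity>i\<in>B. g i w)) ?F"
  proof (rule contour_integral_uniform_limit(2))
    show "uniform_limit (path_image (linepath a b)) (\<lambda>X w. \<Sum>i\<in>X. g i w)
        (\<lambda>w. \<Sum>\<^sub>\<infinity>i\<in>B. g i w) ?F"
      by (rule Weierstrass_m_test_general[OF _ M]) (use bound in auto)
    show "eventually (\<lambda>X. (\<lambda>w. \<Sum>i\<in>X. g i w) contour_integrable_on linepath a b) ?F"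
      using ev by eventually_elim (auto intro!: contour_integrable_sum ig)
    show "norm (vector_derivative (linepath a b) (at t)) \<le> norm (b - a)" for t
      by (simp add: vector_derivative_linepath_at)
  qed auto
  moreover have "eventually (\<lambda>X. contour_integral (linepath a b) (\<lambda>w. \<Sum>i\<in>X. g i w)
      = (\<Sum>i\<in>X. contour_integral (linepath a b) (g i))) ?F"
    using ev by eventually_elim (auto intro!: contour_integral_sum ig)
  ultimately have "((\<lambda>X. \<Sum>i\<in>X. contour_integral (linepath a b) (g i))
           \<longlongrightarrow> contour_integral (linepath a b) (\<lambda>w. \<Sum>\<^sub>\<infinity>i\<in>B. g i w)) ?F"
    by (rule Lim_transform_eventually)
  then show ?thesis
    by (metis has_sum_def infsumI)
qed

lemma norm_contour_integral_linepath_le: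
  assumes "continuous_on (closed_segment 0 b) g" "\<And>w. w \<in> closed_segment 0 b \<Longrightarrow> norm (g w) \<le> M"
  shows "norm (contour_integral (linepath 0 b) g) \<le> norm b * M"
proof -
  have "0 \<le> M"
    by (rule order.trans[OF norm_ge_zero assms(2)[of 0]]) simp
  then have "norm (contour_integral (linepath 0 b) g) \<le> M * norm (b - 0)"
    using assms by (intro contour_integral_bound_linepath contour_integrable_continuous_linepath)
  then show ?thesis
    by (simp add: mult.commute)
qed

text \<open>The coefficients \<open>a\<close> vary in the induction: they absorb the factors whose
  variable has already been fixed by an outer integral.\<close>

lemma iter_cint_infsum_prod:
  fixes g :: "nat \<Rightarrow> 'i \<Rightarrow> complex \<Rightarrow> complex"
  assumes cont: "\<And>i j. i \<in> B \<Longrightarrow> j \<in> set js \<Longrightarrow> continuous_on (closed_segment 0 (z0 j)) (g j i)"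
    and bound: "\<And>i j w. i \<in> B \<Longrightarrow> j \<in> set js \<Longrightarrow> w \<in> closed_segment 0 (z0 j) \<Longrightarrow> norm (g j i w) \<le> M j i"
    and M: "(\<lambda>i. norm (a i) * (\<Prod>j\<in>set js. M j i)) summable_on B"
    and "distinct js"
    and G: "\<And>t'. (\<And>j. j \<notin> set js \<Longrightarrow> t' j = t j) \<Longrightarrow> (\<And>j. j \<in> set js \<Longrightarrow> t' j \<in> closed_segment 0 (z0 j))
              \<Longrightarrow> G t' = (\<Sum>\<^sub>\<infinity>i\<in>B. a i * (\<Prod>j\<in>set js. g j i (t' j)))"
  shows "iter_cint js z0 G t = (\<Sum>\<^sub>\<infinity>i\<in>B. a i * (\<Prod>j\<in>set js. contour_integral (linepath 0 (z0 j)) (g j i)))"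
  using assms
proof (induction js arbitrary: a t)
  case Nil
  then show ?case
    by simp
next
  case (Cons k js)
  let ?I = "\<lambda>j i. contour_integral (linepath 0 (z0 j)) (g j i)"
  have k: "k \<notin> set js" and dist: "distinct js"
    using Cons.prems(4) by auto
  have M_nonneg: "0 \<le> M j i" if "i \<in> B" "j \<in> set (k # js)" for i j
    by (rule order.trans[OF norm_ge_zero Cons.prems(2)[OF that, of 0]]) simp
  have inner: "iter_cint js z0 G (t(k := w)) = (\<Sum>\<^sub>\<infinity>i\<in>B. (a i * g k i w) * (\<Prod>j\<in>set js. ?I j i))"
    if w: "w \<in> closed_segment 0 (z0 k)" for w
  proof (rule Cons.IH)
    show "(\<lambda>i. norm (a i * g k i w) * (\<Prod>j\<in>set js. M j i)) summable_on B"
    proof (rule summable_on_comparison_test[OF Cons.prems(3)])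
      fix i assume i: "i \<in> B"
      have "norm (a i) * norm (g k i w) * (\<Prod>j\<in>set js. M j i)
              \<le> norm (a i) * M k i * (\<Prod>j\<in>set js. M j i)"
        using Cons.prems(2)[OF i _ w] M_nonneg[OF i]
        by (intro mult_right_mono mult_left_mono prod_nonneg) auto
      then show "norm (a i * g k i w) * (\<Prod>j\<in>set js. M j i)
              \<le> norm (a i) * (\<Prod>j\<in>set (k # js). M j i)"
        using k by (simp add: norm_mult mult_ac)
    qed (use M_nonneg in \<open>auto intro!: mult_nonneg_nonneg prod_nonneg\<close>)
    fix t' assume out: "\<And>j. j \<notin> set js \<Longrightarrow> t' j = (t(k := w)) j"
      and ins: "\<And>j. j \<in> set js \<Longrightarrow> t' j \<in> closed_segment 0 (z0 j)"
    have "t' k = w"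
      using out[OF k] by simp
    then have "G t' = (\<Sum>\<^sub>\<infinity>i\<in>B. a i * (\<Prod>j\<in>set (k # js). g j i (t' j)))"
      using out ins w by (intro Cons.prems(5)) (auto split: if_splits)
    also have "\<dots> = (\<Sum>\<^sub>\<infinity>i\<in>B. (a i * g k i w) * (\<Prod>j\<in>set js. g j i (t' j)))"
      using k \<open>t' k = w\<close> by (simp add: mult.assoc)
    finally show "G t' = (\<Sum>\<^sub>\<infinity>i\<in>B. (a i * g k i w) * (\<Prod>j\<in>set js. g j i (t' j)))" .
  qed (use Cons.prems dist in auto)
  have I_le: "norm (?I j i) \<le> norm (z0 j) * M j i" if "i \<in> B" "j \<in> set js" for i j
    using Cons.prems that by (intro norm_contour_integral_linepath_le) auto
  have "iter_cint (k # js) z0 G t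
      = contour_integral (linepath 0 (z0 k)) (\<lambda>w. \<Sum>\<^sub>\<infinity>i\<in>B. (a i * (\<Prod>j\<in>set js. ?I j i)) * g k i w)"
    unfolding iter_cint.simps
    by (rule contour_integral_eq) (simp add: inner mult_ac)
  also have "\<dots> = (\<Sum>\<^sub>\<infinity>i\<in>B. contour_integral (linepath 0 (z0 k))
                     (\<lambda>w. (a i * (\<Prod>j\<in>set js. ?I j i)) * g k i w))"
  \<comment> \<open>Each inner integral costs a segment length \<open>norm (z0 j)\<close>, so the
    given majorant times the product of these lengths dominates.\<close>
  proof (rule contour_integral_infsum_linepath)
    show "(\<lambda>i. (\<Prod>j\<in>set js. norm (z0 j)) * (norm (a i) * (\<Prod>j\<in>set (k # js). M j i))) summable_on B"
      by (intro summable_on_cmult_right Cons.prems(3))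
    fix i w assume i: "i \<in> B" and w: "w \<in> closed_segment 0 (z0 k)"
    have "norm (\<Prod>j\<in>set js. ?I j i) \<le> (\<Prod>j\<in>set js. norm (z0 j) * M j i)"
      unfolding prod_norm[symmetric] using I_le[OF i] by (intro prod_mono) auto
    then have "norm (a i) * norm (\<Prod>j\<in>set js. ?I j i) * norm (g k i w)
        \<le> norm (a i) * (\<Prod>j\<in>set js. norm (z0 j) * M j i) * M k i"
      using Cons.prems(2)[OF i _ w] M_nonneg[OF i]
      by (intro mult_mono mult_left_mono mult_nonneg_nonneg prod_nonneg) auto
    also have "\<dots> = (\<Prod>j\<in>set js. norm (z0 j)) * (norm (a i) * (\<Prod>j\<in>set (k # js). M j i))"
      using k by (simp add: prod.distrib mult_ac)
    finally show "norm ((a i * (\<Prod>j\<in>set js. ?I j i)) * g k i w)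
        \<le> (\<Prod>j\<in>set js. norm (z0 j)) * (norm (a i) * (\<Prod>j\<in>set (k # js). M j i))"
      by (simp add: norm_mult)
  qed (use Cons.prems in \<open>auto intro!: continuous_intros\<close>)
  also have "\<dots> = (\<Sum>\<^sub>\<infinity>i\<in>B. a i * (\<Prod>j\<in>set (k # js). ?I j i))"
  proof (rule infsum_cong)
    fix i assume i: "i \<in> B"
    have "g k i contour_integrable_on linepath 0 (z0 k)"
      using Cons.prems(1)[OF i] by (intro contour_integrable_continuous_linepath) auto
    then show "contour_integral (linepath 0 (z0 k)) (\<lambda>w. (a i * (\<Prod>j\<in>set js. ?I j i)) * g k i w)
        = a i * (\<Prod>j\<in>set (k # js). ?I j i)"
      using k by (subst contour_integral_lmul) (simp_all add: mult_ac)
  qed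
  finally show ?case .
qed

text \<open>The exponential of the sum factors over the coordinates, so the integrand is a series of
  products of one-variable functions and can be integrated factor by factor.\<close>

lemma FJ_eq_infsum:
  assumes "(\<lambda>\<beta>. cmod (f (\<lambda>j. \<alpha> j + \<beta> j)) * (\<Prod>j\<in>{..<n} - J. cmod (z0 j) ^ \<beta> j / fact (\<beta> j)))
             summable_on mi ({..<n} - J)"
  shows "FJ n f z0 J \<alpha> z = (\<Sum>\<^sub>\<infinity>\<beta>\<in>mi ({..<n} - J).
           f (\<lambda>j. \<alpha> j + \<beta> j) * (\<Prod>j\<in>{..<n} - J. lap (z0 j) (\<beta> j) (z j)))"
proof -
  let ?I = "{..<n} - J"
  define g where "g j \<beta> = (\<lambda>t. t ^ \<beta> j / of_nat (fact (\<beta> j)) * exp (- (t / z j)))" for j and \<beta> :: "nat \<Rightarrow> nat"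
  define M where "M j \<beta> = cmod (z0 j) ^ \<beta> j / fact (\<beta> j) * exp (cmod (z0 j) / cmod (z j))" for j and \<beta> :: "nat \<Rightarrow> nat"
  have "iter_cint (sorted_list_of_set ?I) z0
          (\<lambda>t. phiJ n f J \<alpha> t * exp (- (\<Sum>j\<in>?I. t j / z j))) (\<lambda>_. 0)
      = (\<Sum>\<^sub>\<infinity>\<beta>\<in>mi ?I. f (\<lambda>j. \<alpha> j + \<beta> j) *
           (\<Prod>j\<in>set (sorted_list_of_set ?I). contour_integral (linepath 0 (z0 j)) (g j \<beta>)))"
  proof (rule iter_cint_infsum_prod)
    show "continuous_on (closed_segment 0 (z0 j)) (g j \<beta>)" for j \<beta>
      unfolding g_def divide_inverse by (intro continuous_intros)
    \<comment> \<open>The bounds on the exponentials do not depend on \<open>\<beta>\<close> and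
      leave the sum as a constant factor.\<close>
    have "(\<lambda>\<beta>. (\<Prod>j\<in>?I. exp (cmod (z0 j) / cmod (z j))) *
        (cmod (f (\<lambda>j. \<alpha> j + \<beta> j)) * (\<Prod>j\<in>?I. cmod (z0 j) ^ \<beta> j / fact (\<beta> j)))) summable_on mi ?I"
      by (intro summable_on_cmult_right assms)
    then show "(\<lambda>\<beta>. cmod (f (\<lambda>j. \<alpha> j + \<beta> j)) * (\<Prod>j\<in>set (sorted_list_of_set ?I). M j \<beta>)) summable_on mi ?I"
      unfolding M_def prod.distrib by (simp add: mult_ac)
    show "cmod (g j \<beta> w) \<le> M j \<beta>" if "w \<in> closed_segment 0 (z0 j)" for j \<beta> w
      unfolding g_def M_def by (rule norm_power_exp_le_segment[OF that])
    show "phiJ n f J \<alpha> t * exp (- (\<Sum>j\<in>?I. t j / z j))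
        = (\<Sum>\<^sub>\<infinity>\<beta>\<in>mi ?I. f (\<lambda>j. \<alpha> j + \<beta> j) * (\<Prod>j\<in>set (sorted_list_of_set ?I). g j \<beta> (t j)))" for t
    proof -
      have e: "exp (- (\<Sum>j\<in>?I. t j / z j)) = (\<Prod>j\<in>?I. exp (- (t j / z j)))"
        by (simp add: exp_sum flip: sum_negf)
      show ?thesis
        unfolding phiJ_def e
        by (subst infsum_cmult_left'[symmetric], rule infsum_cong)
           (simp only: g_def prod.distrib mult.assoc sorted_list_of_set finite_lessThan finite_Diff)
    qed
  qed auto
  then have "FJ n f z0 J \<alpha> z = inverse (\<Prod>j\<in>?I. z j) * (\<Sum>\<^sub>\<infinity>\<beta>\<in>mi ?I. f (\<lambda>j. \<alpha> j + \<beta> j) *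
      (\<Prod>j\<in>?I. contour_integral (linepath 0 (z0 j)) (g j \<beta>)))"
    by (simp add: FJ_def)
  also have "\<dots> = (\<Sum>\<^sub>\<infinity>\<beta>\<in>mi ?I. inverse (\<Prod>j\<in>?I. z j) * (f (\<lambda>j. \<alpha> j + \<beta> j) *
      (\<Prod>j\<in>?I. contour_integral (linepath 0 (z0 j)) (g j \<beta>))))"
    by (rule infsum_cmult_right'[symmetric])
  also have "\<dots> = (\<Sum>\<^sub>\<infinity>\<beta>\<in>mi ?I. f (\<lambda>j. \<alpha> j + \<beta> j) * (\<Prod>j\<in>?I. lap (z0 j) (\<beta> j) (z j)))"
  proof (rule infsum_cong)
    fix \<beta>
    have "(\<Prod>j\<in>?I. lap (z0 j) (\<beta> j) (z j))
        = inverse (\<Prod>j\<in>?I. z j) * (\<Prod>j\<in>?I. contour_integral (linepath 0 (z0 j)) (g j \<beta>))"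
      unfolding lap_def g_def prod.distrib prod_inversef[unfolded o_def] ..
    then show "inverse (\<Prod>j\<in>?I. z j) * (f (\<lambda>j. \<alpha> j + \<beta> j) *
        (\<Prod>j\<in>?I. contour_integral (linepath 0 (z0 j)) (g j \<beta>)))
      = f (\<lambda>j. \<alpha> j + \<beta> j) * (\<Prod>j\<in>?I. lap (z0 j) (\<beta> j) (z j))"
      by (simp only: mult.left_commute)
  qed
  finally show ?thesis .
qed

subsection \<open>The remainder of the strong expansion\<close>

lemma has_sum_finite_sum:
  fixes f :: "'p \<Rightarrow> 'i \<Rightarrow> 'b :: topological_comm_monoid_add"
  assumes "finite P" "\<And>p. p \<in> P \<Longrightarrow> (f p has_sum s p) B"
  shows "((\<lambda>x. \<Sum>p\<in>P. f p x) has_sum (\<Sum>p\<in>P. s p)) B"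
  using assms by (induction P rule: finite_induct) (auto intro!: has_sum_add)

text \<open>In the applications \<open>w\<close> carries the dependence on the multi-index, so that
  the product of the \<open>D j\<close> leaves the sum as a constant.\<close>

lemma norm_mult_prod_le:
  fixes a :: "'a :: {real_normed_field}"
  assumes "\<And>j. j \<in> I \<Longrightarrow> norm (v j) \<le> w j * D j"
  shows "norm (a * (\<Prod>j\<in>I. v j)) \<le> norm a * (\<Prod>j\<in>I. w j) * (\<Prod>j\<in>I. D j)"
proof -
  have "norm (\<Prod>j\<in>I. v j) \<le> (\<Prod>j\<in>I. w j * D j)"
    unfolding prod_norm[symmetric] using assms by (intro prod_mono) auto
  then have "norm a * norm (\<Prod>j\<in>I. v j) \<le> norm a * (\<Prod>j\<in>I. w j * D j)"
    by (rule mult_left_mono) auto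
  then show ?thesis
    by (simp add: norm_mult prod.distrib mult.assoc)
qed

section \<open>Holomorphy of \<open>F\<close> and its family\<close>

lemma norm_lap_le_of_norm_ge:
  assumes "0 < r" "r \<le> norm z"
  shows "norm (lap a k z) \<le> norm a ^ k / fact k * (norm a * exp (norm a / r) / r)"
proof -
  have "norm a / norm z \<le> norm a / r"
    using assms by (intro divide_left_mono mult_pos_pos) auto
  then have "norm a * exp (norm a / norm z) / norm z \<le> norm a * exp (norm a / r) / r"
    using assms by (intro frac_le mult_left_mono) auto
  then have "norm a ^ k / fact k * (norm a * exp (norm a / norm z) / norm z)
      \<le> norm a ^ k / fact k * (norm a * exp (norm a / r) / r)"
    by (rule mult_left_mono) auto
  with norm_lap_le_crude[of a k z] show ?thesis
    by simp
qed

text \<open>The terms are holomorphic off \<open>0\<close> in the moving coordinate and the series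
  converges uniformly on a disc around \<open>x\<close>, so its sum is holomorphic there.\<close>

lemma FJ_field_differentiable:
  assumes sm: "(\<lambda>\<beta>. cmod (f (\<lambda>j. \<alpha> j + \<beta> j)) * (\<Prod>j\<in>{..<n} - J. cmod (z0 j) ^ \<beta> j / fact (\<beta> j)))
             summable_on mi ({..<n} - J)"
    and "x \<noteq> 0"
  shows "(\<lambda>w. FJ n f z0 J \<alpha> (z(k := w))) field_differentiable (at x)"
proof -
  let ?I = "{..<n} - J"
  \<comment> \<open>Half the modulus keeps every point of the closed disc at distance at least
    \<open>r\<close> from the singularity \<open>0\<close>.\<close>
  define r where "r = norm x / 2"
  have r: "r > 0"
    using assms by (simp add: r_def)
  have ge: "r \<le> norm w" if "w \<in> cball x r" for w
    using that norm_triangle_ineq2[of x w] by (simp add: r_def dist_norm)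
  define G where "G \<beta> w = f (\<lambda>j. \<alpha> j + \<beta> j) * (\<Prod>j\<in>?I. lap (z0 j) (\<beta> j) ((z(k := w)) j))" for \<beta> w
  have hol: "G \<beta> holomorphic_on - {0}" for \<beta>
    unfolding G_def
  proof (intro holomorphic_intros)
    fix j
    show "(\<lambda>w. lap (z0 j) (\<beta> j) ((z(k := w)) j)) holomorphic_on - {0}"
      using holomorphic_lap[of "z0 j" "\<beta> j"] by (cases "j = k") auto
  qed
  have sub: "cball x r \<subseteq> - {0}"
  proof
    fix w assume "w \<in> cball x r"
    then show "w \<in> - {0}"
      using ge[of w] r by auto
  qed
  \<comment> \<open>Only coordinate \<open>k\<close> moves and needs a bound uniform over the
    disc.\<close>
  define D where "D j = (if j = k then norm (z0 j) * exp (norm (z0 j) / r) / r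
      else norm (z0 j) * exp (norm (z0 j) / norm (z j)) / norm (z j))" for j
  have "uniform_limit (cball x r) (\<lambda>X w. \<Sum>\<beta>\<in>X. G \<beta> w) (\<lambda>w. \<Sum>\<^sub>\<infinity>\<beta>\<in>mi ?I. G \<beta> w)
          (finite_subsets_at_top (mi ?I))"
  proof (rule Weierstrass_m_test_general)
    show "norm (G \<beta> w) \<le> cmod (f (\<lambda>j. \<alpha> j + \<beta> j)) * (\<Prod>j\<in>?I. cmod (z0 j) ^ \<beta> j / fact (\<beta> j))
        * (\<Prod>j\<in>?I. D j)" if "w \<in> cball x r" for \<beta> w
      unfolding G_def
    proof (rule norm_mult_prod_le)
      fix j
      show "norm (lap (z0 j) (\<beta> j) ((z(k := w)) j)) \<le> cmod (z0 j) ^ \<beta> j / fact (\<beta> j) * D j"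
        using norm_lap_le_crude[of "z0 j" "\<beta> j" "z j"]
          norm_lap_le_of_norm_ge[OF r ge[OF that], of "z0 j" "\<beta> j"]
        by (cases "j = k") (simp_all only: D_def refl fun_upd_same fun_upd_other if_True if_False not_False_eq_True)
    qed
    show "(\<lambda>\<beta>. cmod (f (\<lambda>j. \<alpha> j + \<beta> j)) * (\<Prod>j\<in>?I. cmod (z0 j) ^ \<beta> j / fact (\<beta> j))
        * (\<Prod>j\<in>?I. D j)) summable_on mi ?I"
      by (intro summable_on_cmult_left sm)
  qed
  then have "(\<lambda>w. \<Sum>\<^sub>\<infinity>\<beta>\<in>mi ?I. G \<beta> w) holomorphic_on ball x r"
  proof (rule holomorphic_uniform_limit[rotated])
    show "eventually (\<lambda>X. continuous_on (cball x r) (\<lambda>w. \<Sum>\<beta>\<in>X. G \<beta> w) \<and>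
        (\<lambda>w. \<Sum>\<beta>\<in>X. G \<beta> w) holomorphic_on ball x r) (finite_subsets_at_top (mi ?I))"
    proof (rule always_eventually, intro allI conjI)
      fix X
      have "(\<lambda>w. \<Sum>\<beta>\<in>X. G \<beta> w) holomorphic_on cball x r"
        by (intro holomorphic_intros holomorphic_on_subset[OF hol sub])
      then show "continuous_on (cball x r) (\<lambda>w. \<Sum>\<beta>\<in>X. G \<beta> w)"
        and "(\<lambda>w. \<Sum>\<beta>\<in>X. G \<beta> w) holomorphic_on ball x r"
        by (auto intro: holomorphic_on_imp_continuous_on holomorphic_on_subset)
    qed
  qed auto
  then have "(\<lambda>w. \<Sum>\<^sub>\<infinity>\<beta>\<in>mi ?I. G \<beta> w) field_differentiable (at x)"
    using r by (auto intro: holomorphic_on_imp_differentiable_at)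
  then show ?thesis
    unfolding G_def FJ_eq_infsum[OF sm] .
qed

section \<open>Inclusion-exclusion and the factorised remainder\<close>

lemma zero_mi: "(\<lambda>_. 0) \<in> mi J"
  by (simp add: mi_def)

text \<open>With no variables left, products and integrals are empty and the series has a single
  term, so the constant members obey the common formula.\<close>

lemma famF_eq_FJ:
  assumes "J \<subseteq> {..<n}"
  shows "famF n f z0 J \<alpha> z = FJ n f z0 J \<alpha> z"
proof (cases "J = {..<n}")
  case True
  have "mi {} = {\<lambda>_. 0}"
    by (auto simp: mi_def)
  then show ?thesis
    using True by (simp add: famF_def FJ_def phiJ_def)
qed (simp add: famF_def)

text \<open>Split each index into its part \<open>H\<close> on \<open>J\<close> and the rest. The
  truncated factors vanish unless \<open>H j < N j\<close> for all \<open>j\<close> in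
  \<open>J\<close>, which leaves finitely many \<open>H\<close>.\<close>

lemma infsum_truncated_mi:
  fixes f :: "(nat \<Rightarrow> nat) \<Rightarrow> complex" and z :: "nat \<Rightarrow> complex" and N :: "nat \<Rightarrow> nat"
  defines "v \<equiv> \<lambda>j k. if k < N j then z j ^ k else 0"
  assumes "J \<subseteq> I" "finite I"
    and sm: "(\<lambda>\<beta>. f \<beta> * ((\<Prod>j\<in>J. v j (\<beta> j)) * (\<Prod>j\<in>I - J. L j (\<beta> j)))) summable_on mi I"
  shows "(\<Sum>\<^sub>\<infinity>\<beta>\<in>mi I. f \<beta> * ((\<Prod>j\<in>J. v j (\<beta> j)) * (\<Prod>j\<in>I - J. L j (\<beta> j))))
      = (\<Sum>H\<in>{H\<in>mi J. \<forall>j\<in>J. H j < N j}.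
          (\<Sum>\<^sub>\<infinity>\<beta>\<in>mi (I - J). f (\<lambda>j. H j + \<beta> j) * (\<Prod>j\<in>I - J. L j (\<beta> j))) * (\<Prod>j\<in>J. z j ^ H j))"
proof -
  let ?t = "\<lambda>\<beta>. f \<beta> * ((\<Prod>j\<in>J. v j (\<beta> j)) * (\<Prod>j\<in>I - J. L j (\<beta> j)))"
  let ?B = "{H\<in>mi J. \<forall>j\<in>J. H j < N j}" and ?K = "mi (I - J)"
  let ?s = "\<lambda>(H, \<beta>). f (\<lambda>j. H j + \<beta> j) * (\<Prod>j\<in>I - J. L j (\<beta> j)) * (\<Prod>j\<in>J. z j ^ H j)"
  have finJ: "finite J"
    using assms finite_subset by blast
  have "finite ((\<lambda>g j. if j \<in> J then g j else 0) ` (\<Pi>\<^sub>E j\<in>J. {..<N j}))"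
    using finJ by (intro finite_imageI finite_PiE) auto
  moreover have "?B \<subseteq> (\<lambda>g j. if j \<in> J then g j else 0) ` (\<Pi>\<^sub>E j\<in>J. {..<N j})"
  proof
    fix H assume H: "H \<in> ?B"
    then have "H = (\<lambda>j. if j \<in> J then (restrict H J) j else 0)"
      by (auto simp: mi_def fun_eq_iff)
    then show "H \<in> (\<lambda>g j. if j \<in> J then g j else 0) ` (\<Pi>\<^sub>E j\<in>J. {..<N j})"
      by (rule image_eqI[where x = "restrict H J"]) (use H in auto)
  qed
  ultimately have finB: "finite ?B"
    using finite_subset by blast
  have split: "?t (\<lambda>j. H j + \<beta> j) = f (\<lambda>j. H j + \<beta> j) * ((\<Prod>j\<in>J. v j (H j)) * (\<Prod>j\<in>I - J. L j (\<beta> j)))"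
    if "H \<in> mi J" "\<beta> \<in> ?K" for H \<beta>
  proof -
    have "(\<Prod>j\<in>J. v j (H j + \<beta> j)) = (\<Prod>j\<in>J. v j (H j))"
      using that by (intro prod.cong) (auto simp: mi_def)
    moreover have "(\<Prod>j\<in>I - J. L j (H j + \<beta> j)) = (\<Prod>j\<in>I - J. L j (\<beta> j))"
      using that by (intro prod.cong) (auto simp: mi_def)
    ultimately show ?thesis
      by simp
  qed
  have inside: "?t (\<lambda>j. H j + \<beta> j) = ?s (H, \<beta>)" if "H \<in> ?B" "\<beta> \<in> ?K" for H \<beta>
  proof -
    have "(\<Prod>j\<in>J. v j (H j)) = (\<Prod>j\<in>J. z j ^ H j)"
      using that by (intro prod.cong) (auto simp: v_def)
    then show ?thesis
      using split[of H \<beta>] that by (simp add: mult_ac)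
  qed
  have outside: "?t (\<lambda>j. H j + \<beta> j) = 0" if H: "H \<in> mi J - ?B" and "\<beta> \<in> ?K" for H \<beta>
  proof -
    obtain j where "j \<in> J" "\<not> H j < N j"
      using H by auto
    then have "j \<in> J" "v j (H j) = 0"
      by (simp_all add: v_def)
    then have "(\<Prod>j\<in>J. v j (H j)) = 0"
      using finJ by (intro prod_zero) auto
    then show ?thesis
      using split[of H \<beta>] that by simp
  qed
  note bij = bij_betw_mi[OF \<open>J \<subseteq> I\<close>]
  have "infsum ?t (mi I) = infsum (\<lambda>p. ?t (case p of (H, \<beta>) \<Rightarrow> \<lambda>j. H j + \<beta> j)) (mi J \<times> ?K)"
    using infsum_reindex_bij_betw[OF bij, of ?t] by simp
  also have "\<dots> = infsum ?s (?B \<times> ?K)"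
  proof (rule infsum_cong_neutral)
    fix p assume "p \<in> mi J \<times> ?K - ?B \<times> ?K"
    then obtain H \<beta> where p: "p = (H, \<beta>)" "H \<in> mi J - ?B" "\<beta> \<in> ?K"
      by blast
    show "?t (case p of (H, \<beta>) \<Rightarrow> \<lambda>j. H j + \<beta> j) = 0"
      unfolding p(1) prod.case by (rule outside[OF p(2,3)])
  next
    fix p assume "p \<in> (mi J \<times> ?K) \<inter> (?B \<times> ?K)"
    then obtain H \<beta> where p: "p = (H, \<beta>)" "H \<in> ?B" "\<beta> \<in> ?K"
      by blast
    show "?t (case p of (H, \<beta>) \<Rightarrow> \<lambda>j. H j + \<beta> j) = ?s p"
      using inside[OF p(2,3)] unfolding p(1) prod.case .
  qed blast
  \<comment> \<open>Iterated summation needs summability over pairs, which the bijection transports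
    from \<open>sm\<close>.\<close>
  also have "\<dots> = (\<Sum>\<^sub>\<infinity>H\<in>?B. \<Sum>\<^sub>\<infinity>\<beta>\<in>?K. ?s (H, \<beta>))"
  proof -
    have "(\<lambda>p. ?t (case p of (H, \<beta>) \<Rightarrow> \<lambda>j. H j + \<beta> j)) summable_on (mi J \<times> ?K)"
      using summable_on_reindex_bij_betw[OF bij, of ?t] sm by simp
    then have "(\<lambda>p. ?t (case p of (H, \<beta>) \<Rightarrow> \<lambda>j. H j + \<beta> j)) summable_on (?B \<times> ?K)"
      by (rule summable_on_subset_banach) auto
    then have "?s summable_on (?B \<times> ?K)"
      by (rule summable_on_cong[THEN iffD1, rotated]) (use inside in auto)
    then show ?thesis
      using infsum_Sigma'_banach[of "\<lambda>H \<beta>. ?s (H, \<beta>)" ?B "\<lambda>_. ?K"] by simp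
  qed
  also have "\<dots> = (\<Sum>H\<in>?B. \<Sum>\<^sub>\<infinity>\<beta>\<in>?K. ?s (H, \<beta>))"
    using finB by (rule infsum_finite)
  finally show ?thesis
    by (simp add: infsum_cmult_left')
qed

text \<open>Expanding the product of the differences \<open>L - v\<close> over subsets
  \<open>J\<close> of coordinates gives \<open>F\<close> from the empty set and \<open>- App\<close>
  from the others; the one-variable estimates then bound each term of the series.\<close>

lemma norm_Fborel_minus_App_le:
  fixes f :: "(nat \<Rightarrow> nat) \<Rightarrow> complex"
  assumes sm: "\<And>J \<alpha>. J \<subseteq> {..<n} \<Longrightarrow> \<alpha> \<in> mi J \<Longrightarrow>
      (\<lambda>\<beta>. cmod (f (\<lambda>j. \<alpha> j + \<beta> j)) * (\<Prod>j\<in>{..<n} - J. cmod (z0 j) ^ \<beta> j / fact (\<beta> j)))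
        summable_on mi ({..<n} - J)"
    and z: "\<And>j. j < n \<Longrightarrow> z0 j \<noteq> 0 \<and> z j \<noteq> 0 \<and> \<kappa> j > 0 \<and>
              \<kappa> j * cmod (z0 j) * cmod (z j) \<le> Re (z j * cnj (z0 j))"
  shows "cmod (Fborel n f z0 z - App n (famF n f z0) N z)
    \<le> (\<Sum>\<^sub>\<infinity>\<beta>\<in>mi {..<n}. cmod (f \<beta>) * (\<Prod>j<n. cmod (z0 j) ^ \<beta> j / fact (\<beta> j)))
       * (\<Prod>j<n. fact (N j) * cmod (z j) ^ N j / (cmod (z0 j) ^ N j * \<kappa> j ^ Suc (N j)))"
proof -
  define L where "L j k = lap (z0 j) k (z j)" for j k
  define v where "v j k = (if k < N j then z j ^ k else 0)" for j k
  define w where "w j k = cmod (z0 j) ^ k / fact k" for j and k :: nat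
  define E where "E j = fact (N j) * cmod (z j) ^ N j / (cmod (z0 j) ^ N j * \<kappa> j ^ Suc (N j))" for j
  define D where "D j = cmod (z0 j) * exp (cmod (z0 j) / cmod (z j)) / cmod (z j)" for j
  have sm0: "(\<lambda>\<beta>. cmod (f \<beta>) * (\<Prod>j<n. w j (\<beta> j))) summable_on mi {..<n}"
    using sm[of "{}" "\<lambda>_. 0"] by (simp add: zero_mi w_def)
  have Lv: "cmod (L j k - v j k) \<le> w j k * E j" if "j < n" for j k
    unfolding L_def v_def w_def E_def using z[OF that] by (intro norm_lap_minus_power_le) auto
  have L: "cmod (L j k) \<le> w j k * D j" for j k
    unfolding L_def w_def D_def by (rule norm_lap_le_crude)
  have w: "0 \<le> w j k" and E: "j < n \<Longrightarrow> 0 \<le> E j" for j k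
    using z[of j] by (auto simp: w_def E_def)
  \<comment> \<open>Writing \<open>v\<close> as \<open>L - (L - v)\<close> puts the truncated powers
    under the same weight, so one majorant serves all mixed products \<open>T J\<close>.\<close>
  have v: "cmod (v j k) \<le> w j k * (D j + E j)" if "j < n" for j k
    using norm_triangle_ineq4[of "L j k" "L j k - v j k"] L[of j k] Lv[OF that, of k]
    by (simp add: algebra_simps)
  have L': "cmod (L j k) \<le> w j k * (D j + E j)" if "j < n" for j k
    using L[of j k] w[of j k] E[OF that] by (simp add: algebra_simps add_increasing2)
  define T where "T J \<beta> = f \<beta> * ((\<Prod>j\<in>J. v j (\<beta> j)) * (\<Prod>j\<in>{..<n} - J. L j (\<beta> j)))" for J \<beta>
  have smT: "T J summable_on mi {..<n}" if J: "J \<subseteq> {..<n}" for J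
  proof (rule abs_summable_summable, rule summable_on_comparison_test)
    show "(\<lambda>\<beta>. cmod (f \<beta>) * (\<Prod>j<n. w j (\<beta> j)) * (\<Prod>j<n. D j + E j)) summable_on mi {..<n}"
      by (intro summable_on_cmult_left sm0)
    fix \<beta>
    have "(\<Prod>j\<in>J. v j (\<beta> j)) * (\<Prod>j\<in>{..<n} - J. L j (\<beta> j))
        = (\<Prod>j<n. if j \<in> J then v j (\<beta> j) else L j (\<beta> j))"
      using J by (subst prod.If_cases) (auto simp: Int_absorb1 Diff_eq)
    moreover have "cmod (f \<beta> * (\<Prod>j<n. if j \<in> J then v j (\<beta> j) else L j (\<beta> j)))
        \<le> cmod (f \<beta>) * (\<Prod>j<n. w j (\<beta> j)) * (\<Prod>j<n. D j + E j)"
      by (rule norm_mult_prod_le) (use v L' in auto)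
    ultimately show "cmod (T J \<beta>) \<le> cmod (f \<beta>) * (\<Prod>j<n. w j (\<beta> j)) * (\<Prod>j<n. D j + E j)"
      by (simp add: T_def)
  qed auto
  have T_App: "infsum (T J) (mi {..<n})
      = (\<Sum>H\<in>{H\<in>mi J. \<forall>j\<in>J. H j < N j}. famF n f z0 J H z * (\<Prod>j\<in>J. z j ^ H j))"
    if J: "J \<subseteq> {..<n}" for J
  proof -
    have "infsum (T J) (mi {..<n}) = (\<Sum>H\<in>{H\<in>mi J. \<forall>j\<in>J. H j < N j}.
        (\<Sum>\<^sub>\<infinity>\<beta>\<in>mi ({..<n} - J). f (\<lambda>j. H j + \<beta> j) * (\<Prod>j\<in>{..<n} - J. L j (\<beta> j))) * (\<Prod>j\<in>J. z j ^ H j))"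
      using smT[OF J] infsum_truncated_mi[OF J, of f N z L] unfolding T_def v_def by simp
    then show ?thesis
      using J by (simp add: famF_eq_FJ FJ_eq_infsum[OF sm] L_def)
  qed
  have expand: "f \<beta> * (\<Prod>j<n. L j (\<beta> j) - v j (\<beta> j)) = (\<Sum>J\<in>Pow {..<n}. (- 1) ^ card J * T J \<beta>)" for \<beta>
  proof -
    have "(\<Prod>j<n. L j (\<beta> j) - v j (\<beta> j)) = (\<Prod>j<n. - v j (\<beta> j) + L j (\<beta> j))"
      by simp
    also have "\<dots> = (\<Sum>J\<in>Pow {..<n}. (\<Prod>j\<in>J. - v j (\<beta> j)) * (\<Prod>j\<in>{..<n} - J. L j (\<beta> j)))"
      by (rule prod_add) simp
    finally show ?thesis
      by (simp add: T_def sum_distrib_left prod_uminus mult_ac)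
  qed
  have "((\<lambda>\<beta>. f \<beta> * (\<Prod>j<n. L j (\<beta> j) - v j (\<beta> j))) has_sum
      (\<Sum>J\<in>Pow {..<n}. (- 1) ^ card J * infsum (T J) (mi {..<n}))) (mi {..<n})"
    unfolding expand by (intro has_sum_finite_sum has_sum_cmult_right has_sum_infsum smT) auto
  also have "(\<Sum>J\<in>Pow {..<n}. (- 1) ^ card J * infsum (T J) (mi {..<n}))
      = infsum (T {}) (mi {..<n})
        + (\<Sum>J\<in>Pow {..<n} - {{}}. (- 1) ^ card J * infsum (T J) (mi {..<n}))"
    by (subst sum.remove[of _ "{}"]) auto
  also have "infsum (T {}) (mi {..<n}) = Fborel n f z0 z"
    using FJ_eq_infsum[OF sm[of "{}" "\<lambda>_. 0"], of z] 
    by (simp add: Fborel_def T_def[abs_def] L_def zero_mi)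
  also have "Pow {..<n} - {{}} = {J. J \<subseteq> {..<n} \<and> J \<noteq> {}}"
    by auto
  \<comment> \<open>The sign \<open>(- 1) ^ card J\<close> is opposite to the one in
    \<open>App\<close>.\<close>
  also have "(\<Sum>J | J \<subseteq> {..<n} \<and> J \<noteq> {}. (- 1) ^ card J * infsum (T J) (mi {..<n}))
      = - App n (famF n f z0) N z"
    by (simp add: App_def T_App flip: sum_negf)
  finally have "((\<lambda>\<beta>. f \<beta> * (\<Prod>j<n. L j (\<beta> j) - v j (\<beta> j))) has_sum
      (Fborel n f z0 z - App n (famF n f z0) N z)) (mi {..<n})"
    by simp
  then have "cmod (Fborel n f z0 z - App n (famF n f z0) N z)
      \<le> infsum (\<lambda>\<beta>. cmod (f \<beta>) * (\<Prod>j<n. w j (\<beta> j))) (mi {..<n}) * (\<Prod>j<n. E j)"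
    by (rule norm_infsum_le)
       (auto intro!: has_sum_cmult_left has_sum_infsum sm0 norm_mult_prod_le Lv)
  then show ?thesis
    by (simp add: w_def E_def)
qed

subsection \<open>Sectors\<close>

text \<open>The angle is arbitrary rather than a principal argument, because a sector about
  \<open>Arg a\<close> can cross the branch cut.\<close>

lemma Re_polar_mult_cnj:
  "Re (complex_of_real \<rho> * cis \<theta> * cnj a) = \<rho> * cmod a * cos (\<theta> - Arg a)"
proof -
  have "cnj a = complex_of_real (cmod a) * cis (- Arg a)"
    by (metis cis_cnj complex_cnj_complex_of_real complex_cnj_mult rcis_cmod_Arg rcis_def)
  then have "complex_of_real \<rho> * cis \<theta> * cnj a
      = complex_of_real (\<rho> * cmod a) * (cis \<theta> * cis (- Arg a))"
    by simp
  then show ?thesis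
    by (simp only: cis_mult) simp
qed

lemma Re_mult_cnj_pos_S0:
  assumes "w \<in> S0 z0 j" "z0 j \<noteq> 0"
  shows "w \<noteq> 0" "0 < Re (w * cnj (z0 j))"
proof -
  obtain \<theta> where \<theta>: "0 < cmod w" "Arg (z0 j) - pi / 2 < \<theta>" "\<theta> < Arg (z0 j) + pi / 2"
      "w = complex_of_real (cmod w) * cis \<theta>"
    using assms(1) unfolding S0_def sector_def by blast
  show "w \<noteq> 0"
    using \<theta>(1) by auto
  have "0 < cmod w * cmod (z0 j) * cos (\<theta> - Arg (z0 j))"
    using \<theta>(1-3) assms(2) by (intro mult_pos_pos cos_gt_zero_pi) auto
  also have "\<dots> = Re (w * cnj (z0 j))"
    using Re_polar_mult_cnj[of "cmod w" \<theta> "z0 j"] \<theta>(4) by metis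
  finally show "0 < Re (w * cnj (z0 j))" .
qed

text \<open>The quotient \<open>Re (w * cnj (z0 j)) / (|w| |z0 j|)\<close> is constant on rays, so it suffices
  to minimise it over the compact arc \<open>|w| = r / 2\<close> of the closed subsector.\<close>

lemma sector_Re_mult_cnj_ge:
  assumes r: "0 < r" and sub: "closure (sector a b (ereal r)) - {0} \<subseteq> S0 z0 j" and z0: "z0 j \<noteq> 0"
  shows "\<exists>\<kappa>>0. \<forall>w\<in>sector a b (ereal r). \<kappa> * cmod (z0 j) * cmod w \<le> Re (w * cnj (z0 j))"
proof (cases "sector a b (ereal r) = {}")
  case True
  then show ?thesis
    by (auto intro: exI[of _ 1])
next
  case False
  let ?S = "sector a b (ereal r)"
  let ?K = "closure ?S \<inter> sphere 0 (r / 2)"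
  \<comment> \<open>Rescaling along the ray to modulus \<open>r / 2 < r\<close> keeps the angle and
    hence stays in the sector.\<close>
  define sc where "sc w = complex_of_real (r / 2 / cmod w) * w" for w
  have sc: "w \<noteq> 0" "sc w \<in> ?K" if ws: "w \<in> ?S" for w
  proof -
    obtain \<theta> where \<theta>: "a < \<theta>" "\<theta> < b" "w = complex_of_real (cmod w) * cis \<theta>" and w: "0 < cmod w"
      using ws unfolding sector_def by blast
    show "w \<noteq> 0"
      using w by auto
    have n: "cmod (sc w) = r / 2"
      using r w by (simp add: sc_def norm_mult norm_divide)
    have "sc w = complex_of_real (r / 2) * cis \<theta>"
      unfolding sc_def by (subst (2) \<theta>(3)) (use w in simp)
    then have "sc w \<in> ?S"
      using r n \<theta> unfolding sector_def by auto
    then show "sc w \<in> ?K"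
      using n closure_subset[of ?S] by auto
  qed
  have ne: "?K \<noteq> {}"
    using False sc(2) by blast
  have cpt: "compact ?K"
    by (auto intro: closed_Int_compact)
  have cont: "continuous_on ?K (\<lambda>w. Re (w * cnj (z0 j)))"
    by (intro continuous_intros)
  obtain m where m: "m \<in> ?K" "\<And>w. w \<in> ?K \<Longrightarrow> Re (m * cnj (z0 j)) \<le> Re (w * cnj (z0 j))"
    using continuous_attains_inf[OF cpt ne cont] by blast
  have "m \<in> S0 z0 j"
    using m(1) r sub by auto
  then have pos: "0 < Re (m * cnj (z0 j))"
    using Re_mult_cnj_pos_S0(2) z0 by blast
  let ?\<kappa> = "Re (m * cnj (z0 j)) / (r / 2 * cmod (z0 j))"
  have "?\<kappa> * cmod (z0 j) * cmod w \<le> Re (w * cnj (z0 j))" if w: "w \<in> ?S" for w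
  proof -
    have "Re (m * cnj (z0 j)) \<le> Re (sc w * cnj (z0 j))"
      by (rule m(2)[OF sc(2)[OF w]])
    also have "\<dots> = r / 2 / cmod w * Re (w * cnj (z0 j))"
      by (simp only: sc_def mult.assoc Re_complex_of_real scaleR_conv_of_real[symmetric]
          mult_scaleR_left scaleR_complex.sel)
    finally have le: "Re (m * cnj (z0 j)) \<le> r / 2 / cmod w * Re (w * cnj (z0 j))" .
    have scale: "p / (r / 2 * y) * y * x \<le> q" if "p \<le> r / 2 / x * q" "0 < x" "0 < y" for p q x y :: real
      using that r by (simp add: field_simps)
    show ?thesis
      by (rule scale[OF le]) (use z0 sc(1)[OF w] in simp_all)
  qed
  moreover have "?\<kappa> > 0"
    using pos r z0 by simp
  ultimately show ?thesis
    by blast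
qed

section \<open>Both claims from one remainder bound\<close>

theorem theorem5p12:
  fixes n :: nat and f :: "(nat \<Rightarrow> nat) \<Rightarrow> complex" and R :: "nat \<Rightarrow> real"
    and z0 :: "nat \<Rightarrow> complex"
  assumes "n \<ge> 1"
    and R_pos: "\<forall>j<n. R j > 0"
    and gevrey: "\<forall>\<delta>>0. \<exists>C>0. \<forall>N\<in>mi {..<n}.
        cmod (f N) \<le> C * (\<Prod>j<n. fact (N j) * (1 / R j + \<delta>) ^ N j)"
    and z0: "\<forall>j<n. z0 j \<noteq> 0 \<and> cmod (z0 j) < R j"
  shows "gevrey_sae n (Fborel n f z0) (famF n f z0) (S0 z0) \<and>
    (\<forall>\<theta>. (\<forall>j<n. Arg (z0 j) - pi / 2 < \<theta> j \<and> \<theta> j < Arg (z0 j) + pi / 2) \<longrightarrow>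
       gevrey_type_dir n (Fborel n f z0) (famF n f z0) (S0 z0)
         (\<lambda>j. cmod (z0 j) * cos (\<theta> j - Arg (z0 j))) \<theta>)"
proof (intro conjI allI impI)
  have sm: "(\<lambda>\<beta>. cmod (f (\<lambda>j. \<alpha> j + \<beta> j)) * (\<Prod>j\<in>{..<n} - J. cmod (z0 j) ^ \<beta> j / fact (\<beta> j)))
        summable_on mi ({..<n} - J)" if "J \<subseteq> {..<n}" "\<alpha> \<in> mi J" for J \<alpha>
    by (rule summable_gevrey[OF R_pos gevrey _ that]) (use z0 in simp)
  define W where "W = (\<Sum>\<^sub>\<infinity>\<beta>\<in>mi {..<n}. cmod (f \<beta>) * (\<Prod>j<n. cmod (z0 j) ^ \<beta> j / fact (\<beta> j)))"
  have W: "W \<ge> 0"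
    unfolding W_def by (intro infsum_nonneg mult_nonneg_nonneg prod_nonneg) auto
  \<comment> \<open>Here \<open>\<kappa>\<close> stays free: compactness supplies it on subsectors,
    the cosine on a ray.\<close>
  have bound: "cmod (Fborel n f z0 z - App n (famF n f z0) N z)
      \<le> W * (\<Prod>j<n. 1 / \<kappa> j) * (\<Prod>j<n. (1 / (cmod (z0 j) * \<kappa> j)) ^ N j * fact (N j) * cmod (z j) ^ N j)"
    if "\<And>j. j < n \<Longrightarrow> z j \<noteq> 0 \<and> \<kappa> j > 0 \<and> \<kappa> j * cmod (z0 j) * cmod (z j) \<le> Re (z j * cnj (z0 j))"
    for z \<kappa> N
  proof -
    have "cmod (Fborel n f z0 z - App n (famF n f z0) N z)
        \<le> W * (\<Prod>j<n. fact (N j) * cmod (z j) ^ N j / (cmod (z0 j) ^ N j * \<kappa> j ^ Suc (N j)))"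
      unfolding W_def using that z0 by (intro norm_Fborel_minus_App_le sm) auto
    \<comment> \<open>One of the \<open>Suc (N j)\<close> powers of \<open>1 / \<kappa> j\<close>
      moves into the constant.\<close>
    also have "(\<Prod>j<n. fact (N j) * cmod (z j) ^ N j / (cmod (z0 j) ^ N j * \<kappa> j ^ Suc (N j)))
        = (\<Prod>j<n. 1 / \<kappa> j * ((1 / (cmod (z0 j) * \<kappa> j)) ^ N j * fact (N j) * cmod (z j) ^ N j))"
      by (intro prod.cong refl) (simp add: power_divide power_mult_distrib)
    finally show ?thesis
      by (simp only: prod.distrib mult.assoc)
  qed
  have holo: "sep_holo ({..<n} - J) (polysector ({..<n} - J) (S0 z0)) (FJ n f z0 J \<alpha>)"
    if "J \<subseteq> {..<n}" "\<alpha> \<in> mi J" for J \<alpha>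
    unfolding sep_holo_def
  proof (intro ballI)
    fix z j assume "z \<in> polysector ({..<n} - J) (S0 z0)" "j \<in> {..<n} - J"
    then have "z j \<noteq> 0"
      using Re_mult_cnj_pos_S0(1)[of "z j" z0 j] z0 by (auto simp: polysector_def)
    then show "(\<lambda>w. FJ n f z0 J \<alpha> (z(j := w))) field_differentiable (at (z j))"
      by (rule FJ_field_differentiable[OF sm[OF that]])
  qed
  show "gevrey_sae n (Fborel n f z0) (famF n f z0) (S0 z0)"
    unfolding gevrey_sae_def
  proof (intro conjI allI impI)
    show "sep_holo {..<n} (polysector {..<n} (S0 z0)) (Fborel n f z0)"
      using holo[of "{}" "\<lambda>_. 0"] by (simp add: zero_mi Fborel_def)
    fix J \<alpha> assume "J \<subseteq> {..<n} \<and> J \<noteq> {} \<and> J \<noteq> {..<n} \<and> \<alpha> \<in> mi J"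
    then show "sep_holo ({..<n} - J) (polysector ({..<n} - J) (S0 z0)) (famF n f z0 J \<alpha>)"
      using holo[of J \<alpha>] by (simp add: ext[OF famF_eq_FJ])
  next
    fix T assume "subpoly n T (S0 z0)"
    then obtain a b r where T: "T = polysector {..<n} (\<lambda>j. sector (a j) (b j) (ereal (r j)))"
      and r: "\<And>j. j < n \<Longrightarrow> 0 < r j \<and> closure (sector (a j) (b j) (ereal (r j))) - {0} \<subseteq> S0 z0 j"
      unfolding subpoly_def by blast
    have "\<exists>\<kappa>. \<forall>j<n. \<kappa> j > 0 \<and> (\<forall>w\<in>sector (a j) (b j) (ereal (r j)).
        \<kappa> j * cmod (z0 j) * cmod w \<le> Re (w * cnj (z0 j)))"
    proof (intro choice allI)
      fix j
      show "\<exists>k. j < n \<longrightarrow> k > 0 \<and> (\<forall>w\<in>sector (a j) (b j) (ereal (r j)).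
          k * cmod (z0 j) * cmod w \<le> Re (w * cnj (z0 j)))"
        using sector_Re_mult_cnj_ge[of "r j" "a j" "b j" z0 j] r z0 by blast
    qed
    then obtain \<kappa> where \<kappa>: "\<And>j. j < n \<Longrightarrow> \<kappa> j > 0 \<and> (\<forall>w\<in>sector (a j) (b j) (ereal (r j)).
        \<kappa> j * cmod (z0 j) * cmod w \<le> Re (w * cnj (z0 j)))"
      by blast
    define A where "A j = 1 / (cmod (z0 j) * \<kappa> j)" for j
    \<comment> \<open>The summand \<open>1\<close> keeps \<open>c\<close> positive even when
      \<open>W = 0\<close>.\<close>
    define c where "c = W * (\<Prod>j<n. 1 / \<kappa> j) + 1"
    have le: "cmod (Fborel n f z0 z - App n (famF n f z0) N z)
        \<le> c * (\<Prod>j<n. A j ^ N j * fact (N j) * cmod (z j) ^ N j)"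
      if "z \<in> T" for z N
    proof -
      have "cmod (Fborel n f z0 z - App n (famF n f z0) N z)
          \<le> W * (\<Prod>j<n. 1 / \<kappa> j) * (\<Prod>j<n. A j ^ N j * fact (N j) * cmod (z j) ^ N j)"
        unfolding A_def
      proof (rule bound)
        fix j assume "j < n"
        then show "z j \<noteq> 0 \<and> \<kappa> j > 0 \<and> \<kappa> j * cmod (z0 j) * cmod (z j) \<le> Re (z j * cnj (z0 j))"
          using \<kappa>[of j] that unfolding T polysector_def by (auto simp: sector_def)
      qed
      also have "\<dots> \<le> c * (\<Prod>j<n. A j ^ N j * fact (N j) * cmod (z j) ^ N j)"
        using \<kappa> by (intro mult_right_mono prod_nonneg) (auto simp: A_def c_def less_imp_le)
      finally show ?thesis .
    qed
    have c_pos: "c > 0"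
      unfolding c_def using W \<kappa>
      by (intro add_nonneg_pos mult_nonneg_nonneg prod_nonneg) (auto simp: less_imp_le)
    have A_pos: "A j > 0" if "j < n" for j
      using \<kappa>[OF that] z0 that by (simp add: A_def)
    show "\<exists>c>0. \<exists>A. (\<forall>j<n. A j > 0) \<and> (\<forall>N\<in>mi {..<n}. \<forall>z\<in>T.
        cmod (Fborel n f z0 z - App n (famF n f z0) N z)
          \<le> c * (\<Prod>j<n. A j ^ N j * fact (N j) * cmod (z j) ^ N j))"
      using c_pos A_pos le by (intro exI[of _ c] conjI exI[of _ A]) simp_all
  qed
  fix \<theta> assume \<theta>: "\<forall>j<n. Arg (z0 j) - pi / 2 < \<theta> j \<and> \<theta> j < Arg (z0 j) + pi / 2"
  \<comment> \<open>With the exact cosine, \<open>cmod (z0 j) * \<kappa> j\<close> is the claimed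
    type.\<close>
  define \<kappa> where "\<kappa> j = cos (\<theta> j - Arg (z0 j))" for j
  have \<kappa>: "\<kappa> j > 0" if "j < n" for j
  proof -
    have "Arg (z0 j) - pi / 2 < \<theta> j" "\<theta> j < Arg (z0 j) + pi / 2"
      using \<theta> that by blast+
    then show ?thesis
      unfolding \<kappa>_def by (intro cos_gt_zero_pi) linarith+
  qed
  show "gevrey_type_dir n (Fborel n f z0) (famF n f z0) (S0 z0)
      (\<lambda>j. cmod (z0 j) * cos (\<theta> j - Arg (z0 j))) \<theta>"
    unfolding gevrey_type_dir_def
  proof (intro allI impI exI ballI)
    fix \<delta> :: real and N z
    assume "\<delta> > 0" and z: "\<forall>j<n. \<exists>\<rho>>0. z j = complex_of_real \<rho> * cis (\<theta> j)"
    have "cmod (Fborel n f z0 z - App n (famF n f z0) N z)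
        \<le> W * (\<Prod>j<n. 1 / \<kappa> j) * (\<Prod>j<n. (1 / (cmod (z0 j) * \<kappa> j)) ^ N j * fact (N j) * cmod (z j) ^ N j)"
    proof (rule bound)
      fix j assume j: "j < n"
      then obtain \<rho> where \<rho>: "\<rho> > 0" "z j = complex_of_real \<rho> * cis (\<theta> j)"
        using z by blast
      show "z j \<noteq> 0 \<and> \<kappa> j > 0 \<and> \<kappa> j * cmod (z0 j) * cmod (z j) \<le> Re (z j * cnj (z0 j))"
        using \<rho> \<kappa>[OF j] unfolding \<rho>(2) Re_polar_mult_cnj by (simp add: \<kappa>_def norm_mult)
    qed
    \<comment> \<open>Adding \<open>\<delta>\<close> only enlarges each base, and the constant in
      front does not depend on it.\<close>
    also have "\<dots> \<le> W * (\<Prod>j<n. 1 / \<kappa> j) *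
        (\<Prod>j<n. (1 / (cmod (z0 j) * \<kappa> j) + \<delta>) ^ N j * fact (N j) * cmod (z j) ^ N j)"
      using \<open>\<delta> > 0\<close> W \<kappa>
      by (intro mult_left_mono prod_mono mult_right_mono power_mono conjI mult_nonneg_nonneg prod_nonneg)
        (auto simp: less_imp_le)
    finally show "cmod (Fborel n f z0 z - App n (famF n f z0) N z)
        \<le> W * (\<Prod>j<n. 1 / \<kappa> j) *
          (\<Prod>j<n. (1 / (cmod (z0 j) * cos (\<theta> j - Arg (z0 j))) + \<delta>) ^ N j * fact (N j) * cmod (z j) ^ N j)"
      unfolding \<kappa>_def .
  qed
qed

end
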